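(* Let $G=(V,E,w)$ be a weighted planar graph with a drawing in the plane and terminal set $K\subseteq V$, and suppose $\gamma(G,K)=\gamma$. Then there are two shortest paths $P_1,P_2$ in $G$ such that for every connected component $C$ of $G\setminus(P_1\cup P_2)$ it holds that $\gamma(G[C],K\cap C)\le\frac23\gamma+1$.
   Context: $G\setminus A$ denotes the graph induced on $V\setminus A$ (here $A$ is the vertex set of $P_1\cup P_2$). A face cover of a terminal set with respect to a drawing is a set of faces such that each terminal lies on some face of the set; $\gamma(H,K')$ is the minimum size of a face cover of $K'$ in $H$, where $G[C]$ is drawn by restricting the drawing of $G$. *)

theory Defs
  imports
    "HOL-Analysis.Analysis"
    "Graph_Theory.Digraph_Component"
    "Graph_Theory.Shortest_Path"
begin

text \<open>
  As usual in \<^theory>\<open>Graph_Theory.Digraph\<close>, a finite simple undirected graph is a symmetric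
  digraph (locale \<^locale>\<open>graph\<close>): an undirected edge is a pair of mutually opposite arcs.  Data
  attached to edges must therefore agree on opposite arcs.
\<close>

definition arc_vs :: "('a, 'b) pre_digraph \<Rightarrow> 'b \<Rightarrow> 'a set" where
  "arc_vs G e = {tail G e, head G e}"

definition edge_weight :: "('a, 'b) pre_digraph \<Rightarrow> 'b weight_fun \<Rightarrow> bool" where
  "edge_weight G w \<longleftrightarrow>
     (\<forall>e \<in> arcs G. 0 \<le> w e) \<and>
     (\<forall>e \<in> arcs G. \<forall>e' \<in> arcs G. arc_vs G e = arc_vs G e' \<longrightarrow> w e = w e')"

definition shortest_path ::
    "('a, 'b) pre_digraph \<Rightarrow> 'b weight_fun \<Rightarrow> 'a \<Rightarrow> 'b awalk \<Rightarrow> 'a \<Rightarrow> bool" where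
  "shortest_path G w u p v \<longleftrightarrow>
     pre_digraph.apath G u p v \<and> ereal (wf_digraph.awalk_cost w p) = wf_digraph.\<mu> G w u v"

text \<open>
  The plane is the type of complex numbers.  Here \<^const>\<open>arc\<close> is an injective path.  Opposite arcs
  may parametrise their common curve independently.
\<close>

locale plane_drawing = graph G
  for G :: "('a, 'b) pre_digraph"
    and pos :: "'a \<Rightarrow> complex"
    and crv :: "'b \<Rightarrow> real \<Rightarrow> complex" +
  assumes inj_pos: "inj_on pos (verts G)"
    and arc_crv: "e \<in> arcs G \<Longrightarrow> Path_Connected.arc (crv e)"
    and pathstart_crv: "e \<in> arcs G \<Longrightarrow> pathstart (crv e) = pos (tail G e)"
    and pathfinish_crv: "e \<in> arcs G \<Longrightarrow> pathfinish (crv e) = pos (head G e)"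
    and vertex_on_crv:
      "\<lbrakk>e \<in> arcs G; v \<in> verts G; pos v \<in> path_image (crv e)\<rbrakk> \<Longrightarrow> v \<in> arc_vs G e"
    and crv_same_edge:
      "\<lbrakk>e \<in> arcs G; e' \<in> arcs G; arc_vs G e = arc_vs G e'\<rbrakk>
        \<Longrightarrow> path_image (crv e) = path_image (crv e')"
    and crv_no_crossing:
      "\<lbrakk>e \<in> arcs G; e' \<in> arcs G; arc_vs G e \<noteq> arc_vs G e'\<rbrakk>
        \<Longrightarrow> path_image (crv e) \<inter> path_image (crv e') \<subseteq> pos ` (arc_vs G e \<inter> arc_vs G e')"

text \<open>
  The following notions depend only on the values of the drawing on the vertices and arcs of the
  given graph; applied to an induced subgraph with the same \<open>pos\<close> and \<open>crv\<close>, they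
  therefore refer to the restricted drawing.
\<close>

definition drawing_image ::
    "('a, 'b) pre_digraph \<Rightarrow> ('a \<Rightarrow> complex) \<Rightarrow> ('b \<Rightarrow> real \<Rightarrow> complex) \<Rightarrow> complex set" where
  "drawing_image G pos crv = pos ` verts G \<union> (\<Union>e \<in> arcs G. path_image (crv e))"

definition faces ::
    "('a, 'b) pre_digraph \<Rightarrow> ('a \<Rightarrow> complex) \<Rightarrow> ('b \<Rightarrow> real \<Rightarrow> complex) \<Rightarrow> complex set set" where
  "faces G pos crv = components (- drawing_image G pos crv)"

text \<open>Faces are open regions; a vertex lies on a face if it is on its boundary.\<close>

definition face_cover ::
    "('a, 'b) pre_digraph \<Rightarrow> ('a \<Rightarrow> complex) \<Rightarrow> ('b \<Rightarrow> real \<Rightarrow> complex) \<Rightarrow> 'a set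
      \<Rightarrow> complex set set \<Rightarrow> bool" where
  "face_cover G pos crv K F \<longleftrightarrow>
     F \<subseteq> faces G pos crv \<and> (\<forall>t \<in> K. \<exists>f \<in> F. pos t \<in> frontier f)"

definition face_cover_number ::
    "('a, 'b) pre_digraph \<Rightarrow> ('a \<Rightarrow> complex) \<Rightarrow> ('b \<Rightarrow> real \<Rightarrow> complex) \<Rightarrow> 'a set \<Rightarrow> nat" where
  "face_cover_number G pos crv K =
     (LEAST n. \<exists>F. face_cover G pos crv K F \<and> finite F \<and> card F = n)"

definition connected_component_verts :: "('a, 'b) pre_digraph \<Rightarrow> 'a set \<Rightarrow> bool" where
  "connected_component_verts G C \<longleftrightarrow>
     (\<exists>H. pre_digraph.max_subgraph G Digraph_Component.connected H \<and> C = verts H)"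

end

theory Submission
  imports Defs
begin

text \<open>
  Choose the connected component of \<open>G\<close> that touches the most faces of an optimal cover \<open>F\<close>: two
  components have at most one face in common, so every other component touches at most
  \<open>(\<gamma> + 1) / 2\<close> of them. In the chosen component take a shortest-path tree, drawn as a compact
  set \<open>T\<close> whose complement is connected. A chord of \<open>T\<close> with ends \<open>u\<close>, \<open>v\<close> that runs through at most
  one face \<open>f\<close> cuts the complement of \<open>T\<close> into two regions, and by Janiszewski's theorem all the faces
  other than \<open>f\<close> that a component of the graph minus the tree paths to \<open>u\<close> and \<open>v\<close> touches
  lie in the same region. Suppose that the two tree paths to \<open>u\<close> and \<open>v\<close> fail for all \<open>u\<close>, \<open>v\<close>.
  Then every chord has a heavy region, which misses fewer than \<open>\<gamma>/3 - 1\<close> faces of \<open>F - {f}\<close>. From a chord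
  with heavy region \<open>H\<close> draw a crosscut inside a face to a non-tree edge in \<open>H\<close>. The crosscut and the
  edge divide \<open>H\<close> into three smaller regions, each bounded by a chord, and since three heavy regions
  always contain a common face, one of the three is heavy. It meets fewer non-tree edges than \<open>H\<close>,
  so the descent cannot go on for ever.
\<close>

text \<open>The obstacle is that a component of the graph minus two tree paths may still cross the
  rest of the tree, so it need not lie on one side of a chord. Only the faces that it touches do:
  the component joins them off the two paths and the chord, the complement of the tree joins them
  off the tree, and these two obstacles intersect in the connected union of the two paths, as
  Janiszewski's theorem requires. Hence sides are taken in the complement of the whole tree.

  The graph need not be triangulated, so a region may have no edge that divides it; a crosscut
  through a face acts as the missing diagonal. It damages its face, which then belongs to neither
  side, and the summand 1 in the bound pays for that. The damage must not accumulate: each crosscut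
  starts where the current chord already runs through \<open>f\<close>, or on the edge that forms
  the chord, and stays inside \<open>f\<close>. So the next chord again has a piece of an edge at
  each end and a middle in \<open>f\<close>, and the edges that it meets vanish together with its
  two ends.\<close>

hide_const (open) Digraph_Component.connected

section \<open>Chords and rays in the plane\<close>

lemma subset_of_side:
  assumes "connected W" "W \<inter> I \<noteq> {}" "W \<inter> frontier I = {}"
  shows "W \<subseteq> I"
  using connected_Int_frontier[of W I] assms by auto

lemma simple_path_image_subset_closure_endless:
  fixes c :: "real \<Rightarrow> 'a::metric_space"
  assumes "simple_path c"
  shows "path_image c \<subseteq> closure (path_image c - {pathstart c, pathfinish c})"
proof -
  have "continuous_on {0..1} c"
    using assms by (auto simp: simple_path_def path_def)
  then have "c ` closure {0<..<1} \<subseteq> closure (c ` {0<..<1})"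
    by (intro image_closure_subset) (auto simp: closure_subset)
  then show ?thesis
    using simple_path_endless[OF assms] by (simp add: path_image_def)
qed

text \<open>An arc inside \<open>X\<close> closes the chord to a Jordan curve \<open>J\<close> that
  adds nothing to \<open>X\<close> but the chord, and \<open>X \<inter> J\<close> is connected. By
  Janiszewski's theorem each side of \<open>J\<close> then cuts only one piece out of
  \<open>U\<close>. A chord that is a loop meets \<open>X\<close> in one point and is already a
  Jordan curve.\<close>

lemma chord_splits_component:
  fixes X :: "complex set"
  assumes X: "compact X" "path_connected X"
    and c: "simple_path c" "pathstart c \<in> X" "pathfinish c \<in> X"
      "path_image c \<inter> X \<subseteq> {pathstart c, pathfinish c}"
    and U: "U \<in> components (- X)" "path_image c \<inter> U \<noteq> {}"
  obtains U1 U2 where "U1 \<noteq> U2"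
    "U1 \<in> components (- (X \<union> path_image c))" "U2 \<in> components (- (X \<union> path_image c))"
    "U1 \<union> U2 = U - path_image c"
    "path_image c \<subseteq> closure U1" "path_image c \<subseteq> closure U2"
proof -
  define C where "C = path_image c"
  define C0 where "C0 = C - {pathstart c, pathfinish c}"
  have "closed X" "open U"
    using X U by (meson compact_imp_closed open_components open_Compl)+
  have UX: "U \<inter> X = {}"
    using U in_components_subset by blast
  have "C0 \<inter> X = {}" "C0 \<inter> U \<noteq> {}"
    using c U UX by (auto simp: C0_def C_def)
  moreover have "connected C0" "C \<subseteq> closure C0"
    unfolding C0_def C_def
    using c(1) connected_simple_path_endless simple_path_image_subset_closure_endless by blast+
  ultimately have C0: "connected C0" "C0 \<inter> X = {}" "C0 \<inter> U \<noteq> {}" "C \<subseteq> closure C0"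
    by blast+
  then have C0U: "C0 \<subseteq> U"
    by (metis U(1) Int_commute components_maximal disjoint_eq_subset_Compl)
  have CX: "C \<subseteq> C0 \<union> X"
    using c by (auto simp: C0_def C_def)
  obtain j where j: "simple_path j" "pathfinish j = pathstart j"
    "connected (X \<inter> path_image j)" "C \<subseteq> path_image j" "path_image j \<subseteq> X \<union> C"
  proof (cases "pathfinish c = pathstart c")
    case True
    then have "X \<inter> path_image c = {pathstart c}"
      using c by auto
    then show ?thesis
      using True c that[of c] by (auto simp: C_def)
  next
    case False
    then obtain d where d: "Path_Connected.arc d" "path_image d \<subseteq> X"
        "pathstart d = pathfinish c" "pathfinish d = pathstart c"
      using X c by (metis path_connected_arcwise)
    have "Path_Connected.arc c"
      using False c(1) simple_path_imp_arc by blast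
    have int: "path_image c \<inter> path_image d \<subseteq> {pathstart c, pathstart d}"
      using c d by auto
    have im: "path_image (c +++ d) = C \<union> path_image d"
      using d by (simp add: C_def path_image_join)
    have "X \<inter> path_image (c +++ d) = path_image d"
      using c d im pathstart_in_path_image[of d] pathfinish_in_path_image[of d]
      by (auto simp: C_def)
    moreover have "simple_path (c +++ d)"
      using d int \<open>Path_Connected.arc c\<close> by (intro simple_path_join_loop) auto
    ultimately show ?thesis
      using d im that[of "c +++ d"] by (auto simp: C_def connected_arc_image)
  qed
  define J where "J = path_image j"
  have XJ: "X \<union> J = X \<union> C"
    using j by (auto simp: J_def)
  have "closed J" "connected (X \<inter> J)"
    using j by (auto simp: J_def closed_simple_path_image)
  have side: "U \<inter> I \<in> components (- (X \<union> C)) \<and> C \<subseteq> closure (U \<inter> I)"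
    if I: "open I" "connected I" "frontier I = J" for I
  proof -
    have IJ: "I \<inter> J = {}"
      using I by (metis Int_commute frontier_disjoint_eq)
    \<comment> \<open>Each side of \<open>J\<close> has all of \<open>J\<close> as its frontier; as
      \<open>C0\<close> lies in the open set \<open>U\<close>, it can be approached inside
      \<open>U\<close>.\<close>
    have "C0 \<subseteq> closure I"
      using I j by (auto simp: J_def C0_def frontier_def)
    then have "C0 \<subseteq> closure (U \<inter> I)"
      using C0U open_Int_closure_subset[OF \<open>open U\<close>] by blast
    then have cl: "C \<subseteq> closure (U \<inter> I)"
      using C0(4) by (meson closed_closure closure_minimal order_trans)
    then have "U \<inter> I \<noteq> {}"
      using C_def by auto
    then obtain a where a: "a \<in> U" "a \<in> I"
      by blast
    define W where "W = connected_component_set (- (X \<union> C)) a"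
    have aW: "a \<in> - (X \<union> C)"
      using a IJ UX XJ by blast
    have W: "W \<in> components (- (X \<union> C))" "a \<in> W" "connected W" "W \<subseteq> - (X \<union> C)"
      unfolding W_def using aW connected_component_subset[of "- (X \<union> C)" a]
      by (simp_all add: componentsI)
    have "W \<subseteq> U"
      using W a U(1) by (intro components_maximal[of U "- X"]) auto
    moreover have "W \<subseteq> I"
      using W a I XJ by (intro subset_of_side) auto
    \<comment> \<open>\<open>U\<close> joins \<open>a\<close> to \<open>b\<close> off
      \<open>X\<close>, and \<open>I\<close> joins them off \<open>J\<close>.\<close>
    moreover have "b \<in> W" if "b \<in> U" "b \<in> I" for b
    proof -
      have "connected_component (- X) a b"
        using U(1) a that unfolding connected_component_def
        by (metis in_components_connected in_components_subset)
      moreover have "connected_component (- J) a b"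
        using I IJ a that by (auto simp: connected_component_def)
      ultimately have "connected_component (- (X \<union> J)) a b"
        using Janiszewski[OF X(1) \<open>closed J\<close> \<open>connected (X \<inter> J)\<close>] by blast
      then show ?thesis
        by (simp add: W_def XJ)
    qed
    ultimately have "W = U \<inter> I" by blast
    then show ?thesis using W cl by blast
  qed
  note JI = Jordan_inside_outside[OF j(1,2), folded J_def]
  show ?thesis
  proof (rule that[of "U \<inter> inside J" "U \<inter> outside J"])
    have "U \<inter> J = U \<inter> C"
      using UX XJ by blast
    moreover have "U \<inter> inside J \<union> U \<inter> outside J = U - U \<inter> J"
      using inside_Un_outside[of J] by blast
    ultimately show "U \<inter> inside J \<union> U \<inter> outside J = U - path_image c"
      by (simp add: C_def Diff_Int)
    have "U \<inter> inside J \<noteq> {}"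
      using side[of "inside J"] JI in_components_nonempty by metis
    then show "U \<inter> inside J \<noteq> U \<inter> outside J"
      using inside_Int_outside[of J] by blast
  qed (use side[of "inside J"] side[of "outside J"] JI in \<open>simp_all add: C_def\<close>)
qed

text \<open>A chord is cut at an interior point \<open>q\<close> into two rays from \<open>q\<close>
  to \<open>X\<close>. In this form the two halves of a chord and a crosscut prolonged to
  \<open>X\<close> are on the same footing, and three of them with a common origin can be permuted
  freely.\<close>

definition ray :: "complex set \<Rightarrow> complex \<Rightarrow> (real \<Rightarrow> complex) \<Rightarrow> bool" where
  "ray X q r \<longleftrightarrow> Path_Connected.arc r \<and> pathstart r = q \<and> q \<notin> X \<and>
     path_image r \<inter> X = {pathfinish r}"

text \<open>Both rays may end at the same point of \<open>X\<close>; hence a simple path, which can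
  be a loop, instead of an arc.\<close>

lemma simple_path_two_rays:
  assumes "ray X q a" "ray X q b" "path_image a \<inter> path_image b \<subseteq> insert q X"
  shows "simple_path (reversepath a +++ b)"
    and "path_image (reversepath a +++ b) = path_image a \<union> path_image b"
proof -
  have ab: "path_image a \<inter> path_image b \<subseteq> {q, pathfinish a, pathfinish b}"
    and ab': "path_image a \<inter> path_image b \<inter> X \<subseteq> {pathfinish a} \<inter> {pathfinish b}"
    using assms by (auto simp: ray_def)
  have arcs: "Path_Connected.arc a" "Path_Connected.arc b" "pathstart a = q" "pathstart b = q"
    using assms by (auto simp: ray_def)
  show "path_image (reversepath a +++ b) = path_image a \<union> path_image b"
    using arcs by (simp add: path_image_join)
  show "simple_path (reversepath a +++ b)"
  proof (cases "pathfinish a = pathfinish b")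
    case True
    then show ?thesis
      using ab arcs by (intro simple_path_join_loop) (auto simp: arc_reversepath)
  next
    case False
    then have "path_image a \<inter> path_image b \<subseteq> {q}"
      using ab ab' assms by (auto simp: ray_def)
    then show ?thesis
      using arcs by (intro arc_imp_simple_path arc_join) (auto simp: arc_reversepath)
  qed
qed

lemma components_two_rays:
  assumes X: "compact X" "path_connected X" "connected (- X)"
    and r: "ray X q a" "ray X q b" "path_image a \<inter> path_image b \<subseteq> insert q X"
  obtains U1 U2 where "U1 \<noteq> U2"
    "components (- (X \<union> path_image a \<union> path_image b)) = {U1, U2}"
    "path_image a \<union> path_image b \<subseteq> closure U1" "path_image a \<union> path_image b \<subseteq> closure U2"
proof -
  define c where "c = reversepath a +++ b"
  note c = simple_path_two_rays[OF r, folded c_def]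
  have "- X \<in> components (- X)"
    using X r by (metis ComplI components_eq_sing_iff empty_iff insertI1 ray_def)
  moreover have "path_image c \<inter> - X \<noteq> {}"
    using r pathstart_in_path_image[of a] by (auto simp: c ray_def)
  moreover have "pathstart c = pathfinish a" "pathfinish c = pathfinish b"
    by (simp_all add: c_def)
  moreover have "path_image c \<inter> X \<subseteq> {pathfinish a, pathfinish b}" "{pathfinish a, pathfinish b} \<subseteq> X"
    unfolding c using r by (auto simp: ray_def)
  ultimately obtain U1 U2 where U: "U1 \<noteq> U2"
    "U1 \<in> components (- (X \<union> path_image c))" "U2 \<in> components (- (X \<union> path_image c))"
    "U1 \<union> U2 = - X - path_image c"
    "path_image c \<subseteq> closure U1" "path_image c \<subseteq> closure U2"
    using chord_splits_component[OF X(1,2) c(1), of "- X"] by (metis insert_subset)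
  have "W = U1 \<or> W = U2" if "W \<in> components (- (X \<union> path_image c))" for W
  proof -
    have "W \<noteq> {}" "W \<subseteq> U1 \<union> U2"
      using U(4) that in_components_nonempty in_components_subset by blast+
    then show ?thesis
      using that U components_nonoverlap by blast
  qed
  then have "components (- (X \<union> path_image c)) = {U1, U2}"
    using U by blast
  then show ?thesis
    using U that[of U1 U2] by (simp add: c Un_assoc)
qed

lemma ray_endless:
  assumes "ray X q r"
  shows "connected (path_image r - insert q X)" "path_image r - insert q X \<noteq> {}"
    "path_image r \<subseteq> closure (path_image r - insert q X)"
proof -
  have *: "path_image r - insert q X = path_image r - {pathstart r, pathfinish r}"
    using assms by (auto simp: ray_def)
  show "connected (path_image r - insert q X)" "path_image r - insert q X \<noteq> {}"
    "path_image r \<subseteq> closure (path_image r - insert q X)"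
    unfolding * using assms connected_simple_path_endless[of r]
      nonempty_simple_path_endless[of r] simple_path_image_subset_closure_endless[of r]
    by (simp_all add: ray_def arc_imp_simple_path)
qed

text \<open>The third ray runs in one of the two regions of the chord formed by \<open>a\<close> and
  \<open>b\<close>. It splits that region in two and leaves the other one, \<open>R\<close>, intact.
  The statements about closures serve to tell the three regions apart when the roles of the rays are
  permuted.\<close>

lemma opposite_region:
  assumes X: "compact X" "path_connected X" "connected (- X)"
    and r: "ray X q a" "ray X q b" "ray X q c"
      "path_image a \<inter> path_image b \<subseteq> insert q X"
      "path_image a \<inter> path_image c \<subseteq> insert q X"
      "path_image b \<inter> path_image c \<subseteq> insert q X"
  obtains R where "R \<in> components (- (X \<union> path_image a \<union> path_image b))"
    "R \<in> components (- (X \<union> path_image a \<union> path_image b \<union> path_image c))"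
    "path_image a \<union> path_image b \<subseteq> closure R"
    "closure R \<inter> (path_image c - insert q X) = {}"
    "R \<inter> path_image c = {}"
    "\<exists>V1 V2. components (- (X \<union> path_image a \<union> path_image b \<union> path_image c)) \<subseteq> {R, V1, V2}"
proof -
  define Y where "Y = X \<union> path_image a \<union> path_image b"
  define c0 where "c0 = path_image c - insert q X"
  have a: "Path_Connected.arc a" "pathstart a = q" "pathfinish a \<in> X" "q \<in> path_image a"
    and b: "Path_Connected.arc b" "pathstart b = q" "pathfinish b \<in> X" "q \<in> path_image b"
    and c: "Path_Connected.arc c" "pathstart c = q" "pathfinish c \<in> X" "q \<in> path_image c"
    using r unfolding ray_def by (metis pathstart_in_path_image insertI1 Int_iff)+
  obtain U1 U2 where U: "U1 \<noteq> U2" "components (- Y) = {U1, U2}"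
    "path_image a \<union> path_image b \<subseteq> closure U1" "path_image a \<union> path_image b \<subseteq> closure U2"
    using components_two_rays[OF X r(1,2,4)] unfolding Y_def by blast
  have "compact Y"
    unfolding Y_def using X a b by (intro compact_Un compact_arc_image)
  have "path_connected Y"
    unfolding Y_def using X a b
    by (intro path_connected_Un path_connected_path_image)
       (auto simp: arc_imp_path intro: pathfinish_in_path_image)
  have c0: "connected c0" "c0 \<noteq> {}" "c0 \<inter> Y = {}"
    using r ray_endless[OF r(3)] unfolding c0_def Y_def by auto
  have "c0 \<subseteq> - Y" using c0 by blast
  then obtain W where W: "W \<in> components (- Y)" "c0 \<subseteq> W"
    using exists_component_superset[of c0 "- Y"] c0 by blast
  define R where "R = (if W = U1 then U2 else U1)"
  have RW: "{R, W} = {U1, U2}" "c0 \<subseteq> W"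
    using W U(1,2) by (auto simp: R_def)
  then have comps: "components (- Y) = {R, W}" "R \<noteq> W"
    using U by auto
  then have R: "R \<in> components (- Y)" and W: "W \<in> components (- Y)"
    by auto
  have "R \<inter> W = {}" "open R" "open W"
    using R W comps(2) \<open>compact Y\<close> components_nonoverlap
    by (blast intro: compact_imp_closed open_components open_Compl)+
  then have clR: "closure R \<inter> W = {}"
    using open_Int_closure_eq_empty by blast
  have cY: "path_image c \<subseteq> c0 \<union> Y"
    using a by (auto simp: c0_def Y_def)
  have Rc: "R \<inter> path_image c = {}"
    using cY RW(2) \<open>R \<inter> W = {}\<close> in_components_subset[OF R] by blast
  have R2: "R \<in> components (- (Y \<union> path_image c))"
  proof (rule components_intermediate_subset[OF R])
    show "R \<subseteq> - (Y \<union> path_image c)"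
      using Rc in_components_subset[OF R] by blast
  qed blast
  have "path_image c \<inter> Y \<subseteq> {pathstart c, pathfinish c}"
    using r c by (auto simp: Y_def ray_def)
  moreover have "pathstart c \<in> Y" "pathfinish c \<in> Y"
    using a c by (auto simp: Y_def)
  moreover have "path_image c \<inter> W \<noteq> {}"
    using RW c0 by (auto simp: c0_def)
  ultimately obtain V1 V2 where V: "V1 \<in> components (- (Y \<union> path_image c))"
      "V2 \<in> components (- (Y \<union> path_image c))" "V1 \<union> V2 = W - path_image c"
    using chord_splits_component[OF \<open>compact Y\<close> \<open>path_connected Y\<close> arc_imp_simple_path[OF c(1)] _ _ _ W]
    by metis
  have "Z \<in> {R, V1, V2}" if Z: "Z \<in> components (- (Y \<union> path_image c))" for Z
  proof -
    have "Z \<noteq> {}" "Z \<subseteq> - Y - path_image c"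
      using Z in_components_nonempty in_components_subset by blast+
    moreover have "- Y = R \<union> W"
      using comps Union_components[of "- Y"] by auto
    ultimately have "Z \<inter> R \<noteq> {} \<or> Z \<inter> V1 \<noteq> {} \<or> Z \<inter> V2 \<noteq> {}"
      using V by blast
    then show ?thesis
      using Z V R2 components_nonoverlap by blast
  qed
  then have "\<exists>V1 V2. components (- (Y \<union> path_image c)) \<subseteq> {R, V1, V2}" by blast
  moreover have "path_image a \<union> path_image b \<subseteq> closure R"
    using RW U by (auto simp: doubleton_eq_iff)
  ultimately show ?thesis
    using that[of R] R R2 Rc clR RW(2) unfolding c0_def Y_def by (metis (no_types) disjoint_iff subsetD)
qed

text \<open>Each pair of rays has a region opposite to the third ray. These three are distinct,
  since the closure of such a region contains the two rays that bound it but misses the interior of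
  the third; and \<open>opposite_region\<close> leaves no room for a fourth.\<close>

lemma tripod_regions:
  assumes X: "compact X" "path_connected X" "connected (- X)"
    and r: "ray X q a" "ray X q b" "ray X q c"
      "path_image a \<inter> path_image b \<subseteq> insert q X"
      "path_image a \<inter> path_image c \<subseteq> insert q X"
      "path_image b \<inter> path_image c \<subseteq> insert q X"
  obtains A B C where
    "A \<in> components (- (X \<union> path_image b \<union> path_image c))" "A \<inter> path_image a = {}"
    "B \<in> components (- (X \<union> path_image a \<union> path_image c))" "B \<inter> path_image b = {}"
    "C \<in> components (- (X \<union> path_image a \<union> path_image b))" "C \<inter> path_image c = {}"
    "A \<inter> B = {}" "A \<inter> C = {}" "B \<inter> C = {}"
    "- (X \<union> path_image a \<union> path_image b \<union> path_image c) = A \<union> B \<union> C"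
proof -
  define Y where "Y = X \<union> path_image a \<union> path_image b \<union> path_image c"
  have Y: "X \<union> path_image a \<union> path_image c \<union> path_image b = Y"
    "X \<union> path_image b \<union> path_image c \<union> path_image a = Y"
    by (auto simp: Y_def)
  have r': "path_image b \<inter> path_image a \<subseteq> insert q X"
      "path_image c \<inter> path_image a \<subseteq> insert q X"
      "path_image c \<inter> path_image b \<subseteq> insert q X"
    using r by auto
  obtain C V1 V2 where C: "C \<in> components (- (X \<union> path_image a \<union> path_image b))"
    "C \<in> components (- Y)" "path_image a \<union> path_image b \<subseteq> closure C"
    "closure C \<inter> (path_image c - insert q X) = {}" "C \<inter> path_image c = {}"
    "components (- Y) \<subseteq> {C, V1, V2}"
    by (rule opposite_region[OF X r, folded Y_def]) (blast intro: that)
  obtain B where B: "B \<in> components (- (X \<union> path_image a \<union> path_image c))"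
    "B \<in> components (- Y)" "path_image a \<union> path_image c \<subseteq> closure B"
    "closure B \<inter> (path_image b - insert q X) = {}" "B \<inter> path_image b = {}"
    by (rule opposite_region[OF X r(1,3,2,5,4) r'(3), unfolded Y]) (rule that)
  obtain A where A: "A \<in> components (- (X \<union> path_image b \<union> path_image c))"
    "A \<in> components (- Y)" "path_image b \<union> path_image c \<subseteq> closure A"
    "closure A \<inter> (path_image a - insert q X) = {}" "A \<inter> path_image a = {}"
    by (rule opposite_region[OF X r(2,3,1,6) r'(1,2), unfolded Y]) (rule that)
  have ne: "S \<noteq> S'" if "closure S \<inter> (r - I) = {}" "r' \<union> r'' \<subseteq> closure S'" "r \<in> {r', r''}" "r - I \<noteq> {}"
    for S S' r r' r'' I :: "complex set"
    using that by blast
  have "A \<noteq> B" "A \<noteq> C" "B \<noteq> C"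
    using ne[OF A(4) B(3)] ne[OF A(4) C(3)] ne[OF B(4) C(3)]
      ray_endless(2)[OF r(1)] ray_endless(2)[OF r(2)] by simp_all
  moreover have "{A, B, C} \<subseteq> components (- Y)"
    using A(2) B(2) C(2) by simp
  moreover have "card {A, B, C} = 3" "card {C, V1, V2} \<le> 3"
    using calculation(1-3) by (simp_all add: card_insert_if)
  ultimately have "components (- Y) = {A, B, C}"
    using C(6) card_seteq[of "{C, V1, V2}" "{A, B, C}"]
    by (smt (verit) dual_order.trans finite.intros subset_antisym)
  then have "- Y = A \<union> B \<union> C"
    using Union_components[of "- Y"] by auto
  moreover have "A \<inter> B = {}" "A \<inter> C = {}" "B \<inter> C = {}"
    using \<open>A \<noteq> B\<close> \<open>A \<noteq> C\<close> \<open>B \<noteq> C\<close> A(2) B(2) C(2) components_nonoverlap by blast+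
  ultimately show ?thesis
    using that[of A B C] A(1,5) B(1,5) C(1,5) unfolding Y_def by simp
qed

lemma ray_join:
  assumes "Path_Connected.arc b" "pathstart b = q" "pathfinish b = p" "ray X p r"
    "path_image b \<inter> X = {}" "path_image b \<inter> path_image r \<subseteq> {p}"
  shows "ray X q (b +++ r)" "path_image (b +++ r) = path_image b \<union> path_image r"
proof -
  have r: "Path_Connected.arc r" "pathstart r = p" "path_image r \<inter> X = {pathfinish r}"
    using assms by (simp_all add: ray_def)
  show im: "path_image (b +++ r) = path_image b \<union> path_image r"
    using assms r by (simp add: path_image_join)
  have "q \<in> path_image b"
    using assms(2) pathstart_in_path_image by blast
  then have "q \<notin> X"
    using assms(5) by blast
  moreover have "Path_Connected.arc (b +++ r)"
    using assms r by (intro arc_join) simp_all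
  moreover have "path_image (b +++ r) \<inter> X = {pathfinish r}"
    unfolding im Int_Un_distrib2 by (simp add: assms r)
  ultimately show "ray X q (b +++ r)"
    using assms by (simp add: ray_def)
qed

lemma rays_of_chord:
  assumes c: "simple_path c" "path_image c \<inter> X = {pathstart c, pathfinish c}"
    and t: "0 < t" "t < 1"
  shows "ray X (c t) (subpath t 0 c)" "ray X (c t) (subpath t 1 c)"
    and "path_image (subpath t 0 c) \<union> path_image (subpath t 1 c) = path_image c"
    and "path_image (subpath t 0 c) \<inter> path_image (subpath t 1 c) \<subseteq> insert (c t) X"
    and "path_image (subpath t 0 c) = c ` {0..t}" "path_image (subpath t 1 c) = c ` {t..1}"
proof -
  show im: "path_image (subpath t 0 c) = c ` {0..t}" "path_image (subpath t 1 c) = c ` {t..1}"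
    using t by (auto simp: path_image_subpath)
  have loop_free: "x = y \<or> x = 0 \<and> y = 1 \<or> x = 1 \<and> y = 0"
    if "x \<in> {0..1}" "y \<in> {0..1}" "c x = c y" for x y
    using c(1) that unfolding simple_path_def loop_free_def by blast
  have ends: "c 0 \<in> X" "c 1 \<in> X"
    using c(2) by (auto simp: pathstart_def pathfinish_def)
  have inX: "x = 0 \<or> x = 1" if "x \<in> {0..1}" "c x \<in> X" for x
  proof -
    have "c x \<in> {c 0, c 1}"
      using c(2) that by (auto simp: path_image_def pathstart_def pathfinish_def)
    then show ?thesis
      using loop_free[of x 0] loop_free[of x 1] that by auto
  qed
  have ct: "c t \<noteq> c 0" "c t \<noteq> c 1" "c t \<notin> X"
    using inX[of t] ends t by auto
  have "c ` {0..t} \<inter> X \<subseteq> {c 0}"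
  proof
    fix z assume "z \<in> c ` {0..t} \<inter> X"
    then obtain x where "x \<in> {0..t}" "z = c x" "c x \<in> X" by auto
    then show "z \<in> {c 0}"
      using inX[of x] t by auto
  qed
  moreover have "c ` {t..1} \<inter> X \<subseteq> {c 1}"
  proof
    fix z assume "z \<in> c ` {t..1} \<inter> X"
    then obtain x where "x \<in> {t..1}" "z = c x" "c x \<in> X" by auto
    then show "z \<in> {c 1}"
      using inX[of x] t by auto
  qed
  moreover have "c 0 \<in> c ` {0..t}" "c 1 \<in> c ` {t..1}"
    using t by auto
  ultimately have imX: "c ` {0..t} \<inter> X = {c 0}" "c ` {t..1} \<inter> X = {c 1}"
    using ends by auto
  have "Path_Connected.arc (subpath t 0 c)" "Path_Connected.arc (subpath t 1 c)"
    using c(1) t ct by (intro arc_simple_path_subpath; auto)+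
  then show "ray X (c t) (subpath t 0 c)" "ray X (c t) (subpath t 1 c)"
    using ct imX by (simp_all add: ray_def im)
  have "{0..t} \<union> {t..1} = {0..1}"
    using t by auto
  then show "path_image (subpath t 0 c) \<union> path_image (subpath t 1 c) = path_image c"
    unfolding im by (simp add: path_image_def flip: image_Un)
  show "path_image (subpath t 0 c) \<inter> path_image (subpath t 1 c) \<subseteq> insert (c t) X"
  proof
    fix z assume "z \<in> path_image (subpath t 0 c) \<inter> path_image (subpath t 1 c)"
    then obtain x y where "x \<in> {0..t}" "y \<in> {t..1}" "z = c x" "z = c y"
      unfolding im by auto
    then show "z \<in> insert (c t) X"
      using loop_free[of x y] ends t by (cases "x = t") auto
  qed
qed

section \<open>Division of a region by a crosscut\<close>

text \<open>
  The rays \<open>r\<close>, \<open>r'\<close> form a chord of \<open>X\<close>, the rays \<open>s\<close>, \<open>s'\<close> form a chord in the region \<open>H\<close> of the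
  first one, and \<open>b\<close> is a crosscut between the two chords.
\<close>

definition crosscut_regions ::
    "complex set \<Rightarrow> (real \<Rightarrow> complex) \<Rightarrow> (real \<Rightarrow> complex) \<Rightarrow> (real \<Rightarrow> complex)
      \<Rightarrow> (real \<Rightarrow> complex) \<Rightarrow> (real \<Rightarrow> complex) \<Rightarrow> complex set
      \<Rightarrow> complex set \<Rightarrow> complex set \<Rightarrow> complex set \<Rightarrow> complex set \<Rightarrow> bool" where
  "crosscut_regions X r r' b s s' H Z R P Q \<longleftrightarrow>
     Z \<in> components (- (X \<union> path_image r \<union> (path_image b \<union> path_image s'))) \<and>
     R \<in> components (- (X \<union> path_image r' \<union> (path_image b \<union> path_image s'))) \<and>
     P \<in> components (- (X \<union> path_image r \<union> (path_image b \<union> path_image s))) \<and>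
     Q \<in> components (- (X \<union> path_image s \<union> path_image s')) \<and>
     R \<subseteq> H \<and> P \<subseteq> H \<and> Q \<subseteq> H \<and> R \<inter> path_image s = {} \<and> P \<inter> path_image s' = {} \<and>
     H - (path_image b \<union> path_image s') \<subseteq> Z \<union> R \<and> Z - path_image s \<subseteq> P \<union> Q"

text \<open>Two tripods are compared. The one at \<open>q\<close> with legs \<open>r\<close>,
  \<open>r'\<close> and \<open>b\<close> followed by \<open>s'\<close> divides \<open>H\<close> into
  \<open>Z\<close> and \<open>R\<close>. The one at \<open>p\<close> with legs \<open>s\<close>,
  \<open>s'\<close> and the reverse of \<open>b\<close> followed by \<open>r\<close> yields
  \<open>P\<close> and \<open>Q\<close>. They share the chord made of \<open>r\<close>,
  \<open>b\<close> and \<open>s'\<close>, whose two sides are \<open>Z\<close> and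
  \<open>A2\<close>; since \<open>s\<close> runs in \<open>Z\<close>, the regions \<open>P\<close>
  and \<open>Q\<close> subdivide \<open>Z\<close>.\<close>

lemma crosscut_regions_exist_aux:
  assumes X: "compact X" "path_connected X" "connected (- X)"
    and r: "ray X q r" "ray X q r'" "path_image r \<inter> path_image r' \<subseteq> insert q X"
    and s: "ray X p s" "ray X p s'" "path_image s \<inter> path_image s' \<subseteq> insert p X"
    and rs: "(path_image r \<union> path_image r') \<inter> (path_image s \<union> path_image s') \<subseteq> X"
    and b: "Path_Connected.arc b" "pathstart b = q" "pathfinish b = p" "path_image b \<inter> X = {}"
      "path_image b \<inter> (path_image r \<union> path_image r') \<subseteq> {q}"
      "path_image b \<inter> (path_image s \<union> path_image s') \<subseteq> {p}"
    and H: "H \<in> components (- (X \<union> path_image r \<union> path_image r'))"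
    and C: "C \<in> components (- (X \<union> path_image r \<union> path_image r'))" "H \<inter> C = {}"
    and R: "R \<in> components (- (X \<union> path_image r' \<union> (path_image b \<union> path_image s')))"
      "R \<inter> path_image r = {}"
    and Z: "Z \<in> components (- (X \<union> path_image r \<union> (path_image b \<union> path_image s')))"
      "Z \<inter> path_image r' = {}"
    and RZC: "R \<inter> Z = {}" "R \<inter> C = {}" "Z \<inter> C = {}"
      "- (X \<union> path_image r \<union> path_image r' \<union> (path_image b \<union> path_image s')) = R \<union> Z \<union> C"
    and sZ: "path_image s - insert p X \<subseteq> Z"
  shows "\<exists>P Q. crosscut_regions X r r' b s s' H Z R P Q"
proof -
  have bp: "p \<in> path_image b" "q \<in> path_image b" "p \<in> path_image s'"
    using b s(2) pathstart_in_path_image pathfinish_in_path_image unfolding ray_def by metis+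
  have rb: "Path_Connected.arc (reversepath b)" "pathstart (reversepath b) = p"
    "pathfinish (reversepath b) = q"
    using b by (simp_all add: arc_reversepath)
  have bs': "ray X q (b +++ s')" "path_image (b +++ s') = path_image b \<union> path_image s'"
    using ray_join[OF b(1-3) s(2) b(4)] b(6) by blast+
  have br: "ray X p (reversepath b +++ r)"
    "path_image (reversepath b +++ r) = path_image b \<union> path_image r"
    using ray_join[OF rb r(1)] b(4,5) by (simp_all add: Int_Un_distrib)
  have int1: "path_image s \<inter> (path_image b \<union> path_image r) \<subseteq> insert p X"
    "path_image s' \<inter> (path_image b \<union> path_image r) \<subseteq> insert p X"
    "path_image r \<inter> (path_image b \<union> path_image s') \<subseteq> insert q X"
    using b(5,6) rs by blast+
  obtain A2 P Q where
    A2: "A2 \<in> components (- (X \<union> path_image s' \<union> (path_image b \<union> path_image r)))"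
      "A2 \<inter> path_image s = {}" and
    P: "P \<in> components (- (X \<union> path_image s \<union> (path_image b \<union> path_image r)))"
      "P \<inter> path_image s' = {}" and
    Q: "Q \<in> components (- (X \<union> path_image s \<union> path_image s'))"
      "Q \<inter> (path_image b \<union> path_image r) = {}" and
    disj: "A2 \<inter> P = {}" "A2 \<inter> Q = {}" and
    un: "- (X \<union> path_image s \<union> path_image s' \<union> (path_image b \<union> path_image r)) = A2 \<union> P \<union> Q"
    using tripod_regions[OF X s(1,2) br(1) s(3), unfolded br(2), OF int1(1,2)] by metis
  have A2': "A2 \<in> components (- (X \<union> path_image r \<union> (path_image b \<union> path_image s')))"
    using A2(1) by (simp add: ac_simps)
  have P': "P \<in> components (- (X \<union> path_image r \<union> (path_image b \<union> path_image s)))"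
    using P(1) by (simp add: ac_simps)
  have "path_image s - insert p X \<noteq> {}"
    by (rule ray_endless(2)[OF s(1)])
  \<comment> \<open>\<open>A2\<close> is the region opposite to \<open>s\<close>, whereas
    \<open>Z\<close> contains the interior of \<open>s\<close>.\<close>
  then have "Z \<noteq> A2"
    using sZ A2(2) by blast
  then have "Z \<inter> A2 = {}"
    using Z(1) A2' components_nonoverlap by metis
  have two: "- (X \<union> path_image r \<union> (path_image b \<union> path_image s')) = Z \<union> A2"
  proof -
    obtain U1 U2 where "components (- (X \<union> path_image r \<union> (path_image b \<union> path_image s'))) = {U1, U2}"
      using components_two_rays[OF X r(1) bs'(1), unfolded bs'(2), OF int1(3)] by metis
    then have "components (- (X \<union> path_image r \<union> (path_image b \<union> path_image s'))) = {Z, A2}"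
      using Z(1) A2' \<open>Z \<noteq> A2\<close> by auto
    then show ?thesis
      using Union_components[of "- (X \<union> path_image r \<union> (path_image b \<union> path_image s'))"] by simp
  qed
  have twoH: "- (X \<union> path_image r \<union> path_image r') = H \<union> C"
  proof -
    obtain U1 U2 where "components (- (X \<union> path_image r \<union> path_image r')) = {U1, U2}"
      using components_two_rays[OF X r] by metis
    moreover have "H \<noteq> C"
      using C H in_components_nonempty by blast
    ultimately have "components (- (X \<union> path_image r \<union> path_image r')) = {H, C}"
      using H C by auto
    then show ?thesis
      using Union_components[of "- (X \<union> path_image r \<union> path_image r')"] by simp
  qed
  note sub = in_components_subset
  have "P \<subseteq> Z"
    using two sub[OF P'] P(2) disj(1) by blast
  have "Q \<subseteq> Z"
    using two sub[OF Q(1)] Q(2) disj(2) by blast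
  have "Z \<subseteq> H"
    using twoH sub[OF Z(1)] Z(2) RZC(3) by blast
  have "R \<subseteq> H"
    using twoH sub[OF R(1)] R(2) RZC(2) by blast
  have "R \<inter> path_image s = {}"
    using sub[OF R(1)] sZ RZC(1) bp by blast
  moreover have "H - (path_image b \<union> path_image s') \<subseteq> Z \<union> R"
    using RZC(4) C(2) sub[OF H] by blast
  moreover have "Z - path_image s \<subseteq> P \<union> Q"
    using un sub[OF Z(1)] \<open>Z \<inter> A2 = {}\<close> by blast
  ultimately show ?thesis
    unfolding crosscut_regions_def
    using Z(1) R(1) P' Q(1) \<open>P \<subseteq> Z\<close> \<open>Q \<subseteq> Z\<close> \<open>Z \<subseteq> H\<close> \<open>R \<subseteq> H\<close> P(2)
    by (intro exI[of _ P] exI[of _ Q] conjI) (assumption | blast)+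
qed

text \<open>The crosscut prolonged by \<open>s'\<close> splits \<open>H\<close> into a part along
  \<open>r\<close> and a part along \<open>r'\<close>, and \<open>s\<close> runs in one of them. An
  exchange of \<open>r\<close> and \<open>r'\<close> makes it the part along \<open>r\<close>, which
  explains the disjunction.\<close>

lemma crosscut_regions_exist:
  assumes X: "compact X" "path_connected X" "connected (- X)"
    and r: "ray X q r" "ray X q r'" "path_image r \<inter> path_image r' \<subseteq> insert q X"
    and s: "ray X p s" "ray X p s'" "path_image s \<inter> path_image s' \<subseteq> insert p X"
    and rs: "(path_image r \<union> path_image r') \<inter> (path_image s \<union> path_image s') \<subseteq> X"
    and b: "Path_Connected.arc b" "pathstart b = q" "pathfinish b = p" "path_image b \<inter> X = {}"
      "path_image b \<inter> (path_image r \<union> path_image r') \<subseteq> {q}"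
      "path_image b \<inter> (path_image s \<union> path_image s') \<subseteq> {p}"
    and H: "H \<in> components (- (X \<union> path_image r \<union> path_image r'))" "p \<in> H"
  shows "\<exists>Z R P Q. crosscut_regions X r r' b s s' H Z R P Q \<or>
    crosscut_regions X r' r b s s' H Z R P Q"
proof -
  have bp: "p \<in> path_image b" "p \<in> path_image s" "p \<in> path_image s'"
    using b s(1,2) pathstart_in_path_image pathfinish_in_path_image unfolding ray_def by metis+
  have bs': "ray X q (b +++ s')" "path_image (b +++ s') = path_image b \<union> path_image s'"
    using ray_join[OF b(1-3) s(2) b(4)] b(6) by blast+
  have int1: "path_image r \<inter> (path_image b \<union> path_image s') \<subseteq> insert q X"
    "path_image r' \<inter> (path_image b \<union> path_image s') \<subseteq> insert q X"
    using b(5,6) rs by blast+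
  obtain A B C where
    A: "A \<in> components (- (X \<union> path_image r' \<union> (path_image b \<union> path_image s')))"
      "A \<inter> path_image r = {}" and
    B: "B \<in> components (- (X \<union> path_image r \<union> (path_image b \<union> path_image s')))"
      "B \<inter> path_image r' = {}" and
    C: "C \<in> components (- (X \<union> path_image r \<union> path_image r'))"
      "C \<inter> (path_image b \<union> path_image s') = {}" and
    disj: "A \<inter> B = {}" "A \<inter> C = {}" "B \<inter> C = {}" and
    un: "- (X \<union> path_image r \<union> path_image r' \<union> (path_image b \<union> path_image s')) = A \<union> B \<union> C"
    using tripod_regions[OF X r(1,2) bs'(1) r(3), unfolded bs'(2), OF int1(1,2)] by metis
  have "H \<noteq> C"
    using H(2) C(2) bp by blast
  then have HC: "H \<inter> C = {}"
    using H(1) C(1) components_nonoverlap by metis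
  define s0 where "s0 = path_image s - insert p X"
  have s0: "connected s0" "s0 \<noteq> {}"
    unfolding s0_def using ray_endless[OF s(1)] by blast+
  \<comment> \<open>Only \<open>p\<close> is known to lie in \<open>H\<close>; as a limit of
    \<open>s0\<close> it carries \<open>s0\<close> along into \<open>H\<close>.\<close>
  have "connected (insert p s0)"
  proof (rule connected_intermediate_closure[OF s0(1)])
    show "insert p s0 \<subseteq> closure s0"
      using ray_endless(3)[OF s(1)] bp(2) closure_subset[of s0] unfolding s0_def by blast
  qed blast
  moreover have "insert p s0 \<subseteq> - (X \<union> path_image r \<union> path_image r')"
    using rs in_components_subset[OF H(1)] H(2) unfolding s0_def by blast
  ultimately have "insert p s0 \<subseteq> H"
    using components_maximal[OF H(1), of "insert p s0"] H(2) by blast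
  moreover have s0_avoids: "s0 \<subseteq> - (X \<union> path_image r \<union> path_image r' \<union> (path_image b \<union> path_image s'))"
    using rs s(3) b(6) bp unfolding s0_def by blast
  ultimately have s0AB: "s0 \<subseteq> A \<union> B"
    using un HC by blast
  show ?thesis
  proof (cases "s0 \<inter> B = {}")
    case False
    have "s0 \<subseteq> B"
      using components_maximal[OF B(1) s0(1)] s0_avoids False by blast
    then show ?thesis
      using crosscut_regions_exist_aux[OF X r s rs b H(1) C(1) HC A B disj un] unfolding s0_def by blast
  next
    case True
    then have "s0 \<inter> A \<noteq> {}"
      using s0 s0AB by blast
    then have s0A: "s0 \<subseteq> A"
      using components_maximal[OF A(1) s0(1)] s0_avoids by blast
    have sym: "X \<union> path_image r' \<union> path_image r = X \<union> path_image r \<union> path_image r'"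
      "path_image r' \<union> path_image r = path_image r \<union> path_image r'"
      "path_image r' \<inter> path_image r = path_image r \<inter> path_image r'"
      "B \<inter> A = A \<inter> B" "B \<union> A \<union> C = A \<union> B \<union> C"
      by auto
    show ?thesis
      using crosscut_regions_exist_aux[OF X r(2,1), unfolded sym, OF r(3) s rs b H(1) C(1) HC B A, unfolded sym,
          OF disj(1,3,2) un] s0A unfolding s0_def by blast
  qed
qed

section \<open>Chords of a drawn spanning tree\<close>

lemma connected_Un_closure:
  assumes "connected A" "connected B" "closure A \<inter> B \<noteq> {}"
  shows "connected (A \<union> B)"
proof -
  obtain z where z: "z \<in> closure A" "z \<in> B"
    using assms by blast
  then have "connected (insert z A)"
    using closure_subset by (intro connected_intermediate_closure[OF assms(1)]) auto
  moreover have "insert z A \<union> B = A \<union> B" "insert z A \<inter> B \<noteq> {}"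
    using z by auto
  ultimately show ?thesis
    using assms(2) connected_Un by metis
qed

text \<open>
  A plane drawing with spanning tree \<open>T\<close>; \<open>P u\<close> is the tree path from the root to \<open>u\<close>,
  and \<open>E\<close> indexes the remaining edges.
\<close>

locale tree_drawing =
  fixes T :: "complex set" and V :: "complex set" and P :: "complex \<Rightarrow> complex set"
    and E :: "'e set" and cr :: "'e \<Rightarrow> real \<Rightarrow> complex"
  assumes T: "compact T" "path_connected T" "connected (- T)"
    and V_nonempty: "V \<noteq> {}"
    and compact_P: "u \<in> V \<Longrightarrow> compact (P u)"
    and P_subset_T: "u \<in> V \<Longrightarrow> P u \<subseteq> T"
    and mem_P: "u \<in> V \<Longrightarrow> u \<in> P u"
    and connected_P: "u \<in> V \<Longrightarrow> v \<in> V \<Longrightarrow> connected (P u \<union> P v)"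
    and finite_E: "finite E"
    and arc_cr: "e \<in> E \<Longrightarrow> Path_Connected.arc (cr e)"
    and ends_cr: "e \<in> E \<Longrightarrow> pathstart (cr e) \<in> V" "e \<in> E \<Longrightarrow> pathfinish (cr e) \<in> V"
    and cr_Int_T: "e \<in> E \<Longrightarrow> path_image (cr e) \<inter> T = {pathstart (cr e), pathfinish (cr e)}"
    and cr_Int_cr: "e \<in> E \<Longrightarrow> e' \<in> E \<Longrightarrow> path_image (cr e) = path_image (cr e') \<or>
      path_image (cr e) \<inter> path_image (cr e') \<subseteq> T"
begin

definition drawing :: "complex set" where
  "drawing = T \<union> (\<Union>e\<in>E. path_image (cr e))"

lemma closed_T: "closed T"
  using T compact_imp_closed by blast

lemma T_subset_drawing: "T \<subseteq> drawing"
  by (auto simp: drawing_def)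

lemma compact_drawing: "compact drawing"
  unfolding drawing_def using T finite_E arc_cr compact_arc_image
  by (intro compact_Un compact_UN) auto

lemma closed_drawing: "closed drawing"
  using compact_drawing compact_imp_closed by blast

lemma same_edge:
  assumes "e \<in> E" "e' \<in> E" "z \<in> path_image (cr e)" "z \<in> path_image (cr e')" "z \<notin> T"
  shows "path_image (cr e) = path_image (cr e')"
  using cr_Int_cr assms by blast

lemma edge_interior:
  assumes "e \<in> E"
  shows "path_image (cr e) - T = cr e ` {0<..<1}" "connected (path_image (cr e) - T)"
    "path_image (cr e) - T \<noteq> {}"
proof -
  have sp: "simple_path (cr e)"
    using assms arc_cr arc_imp_simple_path by blast
  have eq: "path_image (cr e) - T = path_image (cr e) - {pathstart (cr e), pathfinish (cr e)}"
    using cr_Int_T[OF assms] by blast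
  then show "path_image (cr e) - T = cr e ` {0<..<1}"
    using simple_path_endless[OF sp] by simp
  show "connected (path_image (cr e) - T)" "path_image (cr e) - T \<noteq> {}"
    unfolding eq using sp connected_simple_path_endless nonempty_simple_path_endless by blast+
qed

text \<open>Opposite arcs have the same curve, so edges are told apart by their images and not by
  their indices.\<close>

definition other_edges :: "'e \<Rightarrow> complex set" where
  "other_edges e = T \<union> (\<Union>e'\<in>{e'\<in>E. path_image (cr e') \<noteq> path_image (cr e)}. path_image (cr e'))"

lemma closed_other_edges: "closed (other_edges e)"
  unfolding other_edges_def using finite_E arc_cr closed_T
  by (intro closed_Un closed_UN) (auto simp: closed_arc_image)

lemma drawing_minus_other_edges:
  assumes "e \<in> E"
  shows "drawing - other_edges e = path_image (cr e) - T"
  using assms same_edge unfolding drawing_def other_edges_def by blast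

text \<open>The value \<open>f = {}\<close> encodes that the chord runs along the drawing only.\<close>

definition chord_via :: "complex set \<Rightarrow> (real \<Rightarrow> complex) \<Rightarrow> bool" where
  "chord_via f c \<longleftrightarrow> (f = {} \<or> f \<in> components (- drawing)) \<and> simple_path c \<and>
     pathstart c \<in> V \<and> pathfinish c \<in> V \<and> path_image c \<inter> T = {pathstart c, pathfinish c} \<and>
     path_image c \<subseteq> drawing \<union> f \<and>
     (\<forall>e\<in>E. (path_image (cr e) - T) \<inter> path_image c \<noteq> {} \<longrightarrow>
        pathstart c \<in> path_image (cr e) \<or> pathfinish c \<in> path_image (cr e))"

lemma chord_via_edge: "e \<in> E \<Longrightarrow> chord_via {} (cr e)"
  unfolding chord_via_def
proof (intro conjI ballI impI)
  assume e: "e \<in> E"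
  show "pathstart (cr e) \<in> path_image (cr e') \<or> pathfinish (cr e) \<in> path_image (cr e')"
    if "e' \<in> E" "(path_image (cr e') - T) \<inter> path_image (cr e) \<noteq> {}" for e'
    using same_edge[OF that(1) e] that(2) by blast
  show "path_image (cr e) \<subseteq> drawing \<union> {}"
    using e by (auto simp: drawing_def)
qed (use arc_cr arc_imp_simple_path ends_cr cr_Int_T in auto)

lemma chord_subset_closure_region:
  assumes c: "simple_path c" "path_image c \<inter> T = {pathstart c, pathfinish c}"
    and H: "H \<in> components (- (T \<union> path_image c))"
  shows "path_image c \<subseteq> closure H"
proof -
  note r = rays_of_chord[OF c, of "1/2", simplified]
  have "T \<union> path_image (subpath (1/2) 0 c) \<union> path_image (subpath (1/2) 1 c) = T \<union> path_image c"
    using r(3) by blast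
  then obtain U1 U2 where "components (- (T \<union> path_image c)) = {U1, U2}"
    "path_image c \<subseteq> closure U1" "path_image c \<subseteq> closure U2"
    using components_two_rays[OF T r(1,2,4)] r(3) by metis
  moreover from this have "H = U1 \<or> H = U2"
    using H by simp
  ultimately show ?thesis
    by metis
qed

text \<open>Models the drawing of a component of the graph without the two tree paths. It may cross
  the tree elsewhere, but no edge at \<open>u\<close> or \<open>v\<close> survives the removal of
  these vertices, so the interiors of such edges are excluded.\<close>

definition separator :: "complex \<Rightarrow> complex \<Rightarrow> complex set \<Rightarrow> bool" where
  "separator u v Q \<longleftrightarrow> connected Q \<and> Q \<subseteq> drawing \<and> Q \<inter> (P u \<union> P v) = {} \<and>
     (\<forall>e\<in>E. u \<in> path_image (cr e) \<or> v \<in> path_image (cr e) \<longrightarrow> Q \<inter> (path_image (cr e) - T) = {})"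

lemma touched_faces_same_side:
  assumes c: "chord_via f c" and Q: "separator (pathstart c) (pathfinish c) Q"
    and g: "g \<in> components (- drawing)" "g \<noteq> f" "closure g \<inter> Q \<noteq> {}"
    and h: "h \<in> components (- drawing)" "h \<noteq> f" "closure h \<inter> Q \<noteq> {}"
    and H: "H \<in> components (- (T \<union> path_image c))" "g \<subseteq> H"
  shows "h \<subseteq> H"
proof -
  define u v where "u = pathstart c" and "v = pathfinish c"
  define Y where "Y = P u \<union> P v \<union> path_image c"
  have uv: "u \<in> V" "v \<in> V"
    using c by (auto simp: chord_via_def u_def v_def)
  have cT: "path_image c \<inter> T = {u, v}" "path_image c \<subseteq> drawing \<union> f"
    and f: "f = {} \<or> f \<in> components (- drawing)"
    using c by (auto simp: chord_via_def u_def v_def)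
  have face: "k \<inter> (T \<union> path_image c) = {} \<and> k \<inter> Y = {} \<and> connected k \<and> k \<noteq> {}"
    if k: "k \<in> components (- drawing)" "k \<noteq> f" for k
  proof -
    have "k \<inter> f = {}"
      using f k components_nonoverlap by blast
    moreover have "k \<subseteq> - drawing"
      using k(1) by (rule in_components_subset)
    moreover have "P u \<union> P v \<subseteq> T" "T \<subseteq> drawing"
      using P_subset_T uv T_subset_drawing by auto
    ultimately have "k \<inter> (T \<union> path_image c) = {} \<and> k \<inter> Y = {}"
      using cT(2) unfolding Y_def by blast
    then show ?thesis
      using k in_components_connected in_components_nonempty by blast
  qed
  \<comment> \<open>A point of \<open>Q\<close> on the chord is not in \<open>f\<close>, as
    \<open>Q\<close> is part of the drawing, and it is not an end of the chord; so it lies inside an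
    edge that the chord meets. Such an edge ends at \<open>u\<close> or \<open>v\<close>, and
    \<open>Q\<close> avoids its interior.\<close>
  have QY: "Q \<inter> Y = {}"
  proof -
    have "Q \<inter> (P u \<union> P v) = {}" "Q \<subseteq> drawing"
      using Q by (auto simp: separator_def u_def v_def)
    moreover have "z \<notin> Q" if z: "z \<in> path_image c" for z
    proof
      assume zQ: "z \<in> Q"
      then have "z \<notin> P u \<union> P v" "z \<in> drawing"
        using calculation by auto
      then have "z \<notin> T"
        using z cT(1) mem_P[OF uv(1)] mem_P[OF uv(2)] by auto
      then obtain e where e: "e \<in> E" "z \<in> path_image (cr e) - T"
        using \<open>z \<in> drawing\<close> by (auto simp: drawing_def)
      then have "u \<in> path_image (cr e) \<or> v \<in> path_image (cr e)"
        using c z unfolding chord_via_def u_def v_def by blast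
      then show False
        using Q e zQ unfolding separator_def u_def v_def by blast
    qed
    ultimately show ?thesis
      unfolding Y_def by blast
  qed
  have "connected (g \<union> Q)"
    using face[OF g(1,2)] Q g(3) by (intro connected_Un_closure) (auto simp: separator_def)
  moreover have "connected (h \<union> Q)"
    using face[OF h(1,2)] Q h(3) by (intro connected_Un_closure) (auto simp: separator_def)
  moreover have "(g \<union> Q) \<inter> (h \<union> Q) \<noteq> {}"
    using g(3) by blast
  ultimately have con: "connected ((g \<union> Q) \<union> (h \<union> Q))"
    by (rule connected_Un)
  obtain a b where ab: "a \<in> g" "b \<in> h"
    using face[OF g(1,2)] face[OF h(1,2)] by auto
  have "connected_component (- Y) a b"
  proof -
    have "(g \<union> Q) \<union> (h \<union> Q) \<subseteq> - Y"
      using QY face[OF g(1,2)] face[OF h(1,2)] by auto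
    then show ?thesis
      using con ab unfolding connected_component_def
      by (intro exI[of _ "(g \<union> Q) \<union> (h \<union> Q)"]) simp
  qed
  moreover have "connected_component (- T) a b"
  proof -
    have "a \<notin> T" "b \<notin> T"
      using face[OF g(1,2)] face[OF h(1,2)] ab by auto
    then show ?thesis
      using T(3) unfolding connected_component_def by (intro exI[of _ "- T"]) simp
  qed
  \<comment> \<open>The chord meets \<open>T\<close> only in \<open>u\<close> and \<open>v\<close>,
    so \<open>T\<close> and \<open>Y\<close> share just the two tree paths, whose union is
    connected; \<open>Q\<close> may well cross the rest of \<open>T\<close>.\<close>
  moreover have "T \<inter> Y = P u \<union> P v"
    using cT(1) mem_P[OF uv(1)] mem_P[OF uv(2)] P_subset_T[OF uv(1)] P_subset_T[OF uv(2)]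
    unfolding Y_def by auto
  then have "connected (T \<inter> Y)"
    using connected_P uv by simp
  moreover have "closed Y"
    using c compact_P uv unfolding Y_def chord_via_def
    by (intro closed_Un) (auto simp: compact_imp_closed closed_simple_path_image)
  ultimately have "connected_component (- (T \<union> Y)) a b"
    using Janiszewski[OF T(1)] by blast
  moreover have "T \<union> Y = T \<union> path_image c"
    using P_subset_T uv unfolding Y_def by blast
  ultimately obtain S where S: "connected S" "S \<subseteq> - (T \<union> path_image c)" "a \<in> S" "b \<in> S"
    unfolding connected_component_def by metis
  have "S \<subseteq> H"
    using components_maximal[OF H(1) S(1,2)] S(3) ab H(2) by blast
  then show ?thesis
    using components_maximal[OF H(1), of h] face[OF h(1,2)] S(4) ab(2) by blast
qed

text \<open>The invariant of the descent. The chord \<open>c\<close> runs through \<open>f\<close> at the parameters between \<open>a\<close>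
  and \<open>b\<close>, unless \<open>c\<close> is an edge. Near these parameters, the face part \<open>W\<close> in the region \<open>H\<close> is
  accessible.\<close>

definition descent_state :: "complex set \<Rightarrow> (real \<Rightarrow> complex) \<Rightarrow> real \<Rightarrow> real \<Rightarrow>
    complex set \<Rightarrow> complex set \<Rightarrow> complex set \<Rightarrow> bool" where
  "descent_state f c a b H W S \<longleftrightarrow>
     f \<in> components (- drawing) \<and> simple_path c \<and>
     pathstart c \<in> V \<and> pathfinish c \<in> V \<and> path_image c \<inter> T = {pathstart c, pathfinish c} \<and>
     path_image c \<subseteq> drawing \<union> f \<and> 0 \<le> a \<and> b \<le> 1 \<and>
     (\<forall>e\<in>E. \<forall>s\<in>{0..<b}. c s \<in> path_image (cr e) - T \<longrightarrow> pathstart c \<in> path_image (cr e)) \<and>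
     (\<forall>e\<in>E. \<forall>s\<in>{a<..1}. c s \<in> path_image (cr e) - T \<longrightarrow> pathfinish c \<in> path_image (cr e)) \<and>
     H \<in> components (- (T \<union> path_image c)) \<and>
     (\<forall>e\<in>E. path_image (cr e) \<inter> H \<noteq> {} \<longrightarrow> (path_image (cr e) - T) \<inter> path_image c = {}) \<and>
     W \<in> components (- (drawing \<union> path_image c)) \<and> W \<subseteq> H \<and> W \<subseteq> f \<and>
     open S \<and> S \<inter> frontier W \<noteq> {} \<and> S \<inter> (drawing \<union> path_image c) \<subseteq> c ` {a<..<b}"

text \<open>Provides the face part \<open>W\<close> of a descent state. As \<open>z\<close> is a
  limit of points of \<open>H\<close>, the neighbourhood \<open>S\<close> contains such a point, and
  it is off the drawing because \<open>S\<close> meets no obstacle but the chord. Since the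
  connected \<open>S\<close> also contains \<open>z\<close>, which is outside \<open>W\<close>, it
  meets the frontier of \<open>W\<close>.\<close>

lemma launch_face:
  assumes H: "H \<in> components (- (T \<union> path_image c))"
    and S: "open S" "connected S" "S \<inter> (drawing \<union> path_image c) \<subseteq> path_image c"
    and z: "z \<in> S" "z \<in> path_image c" "z \<in> closure H"
  obtains W where "W \<in> components (- (drawing \<union> path_image c))" "W \<subseteq> H"
    "S \<inter> frontier W \<noteq> {}" "W \<inter> S \<noteq> {}"
proof -
  obtain y where y: "y \<in> S" "y \<in> H"
    using z S(1) open_Int_closure_eq_empty by blast
  then have "y \<in> - (drawing \<union> path_image c)"
    using S(3) in_components_subset[OF H] by blast
  then obtain W where W: "W \<in> components (- (drawing \<union> path_image c))" "y \<in> W"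
    using UnionE Union_components by metis
  have "W \<subseteq> - (T \<union> path_image c)"
    using in_components_subset[OF W(1)] T_subset_drawing by blast
  then have "W \<subseteq> H"
    using components_maximal[OF H in_components_connected[OF W(1)]] y W(2) by blast
  moreover have "z \<notin> W"
    using in_components_subset[OF W(1)] z by blast
  then have "S \<inter> frontier W \<noteq> {}"
    using connected_Int_frontier[OF S(2), of W] y W(2) z(1) by blast
  ultimately show ?thesis
    using that W y by blast
qed

lemma edge_descent_state:
  assumes e: "e \<in> E" and H: "H \<in> components (- (T \<union> path_image (cr e)))"
  obtains f W S where "descent_state f (cr e) 0 1 H W S"
proof -
  define c where "c = cr e"
  have c: "simple_path c" "path_image c \<inter> T = {pathstart c, pathfinish c}" "path_image c \<subseteq> drawing"
    "pathstart c \<in> V" "pathfinish c \<in> V"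
    using chord_via_edge[OF e] by (auto simp: chord_via_def c_def)
  have "path_image c - T \<noteq> {}"
    using edge_interior(3)[OF e] by (simp add: c_def)
  then obtain z where z: "z \<in> path_image c" "z \<notin> T"
    by blast
  then have "z \<notin> other_edges e"
    using same_edge[OF e] unfolding other_edges_def c_def by blast
  then obtain r where r: "r > 0" "ball z r \<subseteq> - other_edges e"
    using closed_other_edges by (meson ComplI open_Compl open_contains_ball)
  define S where "S = ball z r"
  have Dc: "drawing \<union> path_image c = drawing"
    using c by blast
  have S: "S \<inter> (drawing \<union> path_image c) \<subseteq> path_image c - T"
  proof -
    have "S \<inter> drawing \<subseteq> drawing - other_edges e"
      using r(2) unfolding S_def by blast
    then show ?thesis
      unfolding Dc using drawing_minus_other_edges[OF e] by (simp add: c_def)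
  qed
  have zH: "z \<in> closure H"
    using chord_subset_closure_region[OF c(1,2)] H z by (auto simp: c_def)
  have Hc: "H \<in> components (- (T \<union> path_image c))"
    using H by (simp add: c_def)
  obtain W where W: "W \<in> components (- (drawing \<union> path_image c))" "W \<subseteq> H"
    "S \<inter> frontier W \<noteq> {}" "W \<inter> S \<noteq> {}"
    using launch_face[OF Hc, of S z] S z zH r(1) unfolding S_def by auto
  have int: "path_image c - T = c ` {0<..<1}"
    using edge_interior(1)[OF e] by (simp add: c_def)
  have same: "path_image (cr e') = path_image c" if "e' \<in> E" "c s \<in> path_image (cr e') - T" "s \<in> {0..1}" for e' s
    using same_edge[OF that(1) e, of "c s"] that(2,3) by (auto simp: c_def path_image_def)
  \<comment> \<open>The chord is part of the drawing, so \<open>W\<close> is a whole face and can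
    itself serve as \<open>f\<close>. The whole edge is the stretch from which a crosscut may
    start.\<close>
  have "descent_state W c 0 1 H W S"
    unfolding descent_state_def
  proof (intro conjI ballI impI)
    show "W \<in> components (- drawing)"
      using W(1) Dc by simp
    show "pathstart c \<in> path_image (cr e')" if "e' \<in> E" "s \<in> {0..<1}" "c s \<in> path_image (cr e') - T" for e' s
      using same[OF that(1,3)] that(2) by auto
    show "pathfinish c \<in> path_image (cr e')" if "e' \<in> E" "s \<in> {0<..1}" "c s \<in> path_image (cr e') - T" for e' s
      using same[OF that(1,3)] that(2) by auto
    show "(path_image (cr e') - T) \<inter> path_image c = {}" if e': "e' \<in> E" "path_image (cr e') \<inter> H \<noteq> {}" for e'
    proof (rule ccontr)
      assume "(path_image (cr e') - T) \<inter> path_image c \<noteq> {}"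
      then have "path_image (cr e') = path_image c"
        using same_edge[OF e'(1) e] by (auto simp: c_def)
      then show False
        using e' in_components_subset[OF Hc] by blast
    qed
    show "S \<inter> (drawing \<union> path_image c) \<subseteq> c ` {0<..<1}"
      using S int by blast
    show "open S" by (simp add: S_def)
  qed (use c W Hc in auto)
  then show ?thesis
    using that by (auto simp: c_def)
qed

text \<open>The bounds come from the parametrisation of \<open>c\<close>: the ray \<open>r\<close>
  occupies the times up to \<open>1/2\<close>, the crosscut \<open>b\<close> those from
  \<open>1/2\<close> to \<open>3/4\<close>, and \<open>s\<close> the rest. Before \<open>3/4\<close>
  the chord meets only interiors of edges at its start, after \<open>1/2\<close> only that of the
  edge \<open>l\<close> at its finish, and strictly in between, inside \<open>W\<close>, none at
  all.\<close>

lemma crosscut_chord: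
  assumes f: "f \<in> components (- drawing)"
    and r: "ray T q r" "path_image r \<subseteq> drawing \<union> f" "pathfinish r \<in> V"
      "\<forall>e\<in>E. (path_image (cr e) - T) \<inter> path_image r \<noteq> {} \<longrightarrow> pathfinish r \<in> path_image (cr e)"
    and s: "ray T p s" "l \<in> E" "path_image s \<subseteq> path_image (cr l)"
    and b: "Path_Connected.arc b" "pathstart b = q" "pathfinish b = p" "b ` {0<..<1} \<subseteq> W"
      "W \<subseteq> f" "path_image b \<inter> T = {}" "path_image b \<inter> path_image r \<subseteq> {q}" "path_image b \<inter> path_image s \<subseteq> {p}"
    and rs: "path_image r \<inter> path_image s \<subseteq> T"
  defines "c \<equiv> reversepath r +++ (b +++ s)"
  shows "chord_via f c" "path_image c = path_image r \<union> (path_image b \<union> path_image s)"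
    "pathstart c = pathfinish r" "pathfinish c = pathfinish s"
    "\<And>e t. e \<in> E \<Longrightarrow> t \<in> {0..<3/4} \<Longrightarrow> c t \<in> path_image (cr e) - T \<Longrightarrow> pathstart c \<in> path_image (cr e)"
    "\<And>e t. e \<in> E \<Longrightarrow> t \<in> {1/2<..1} \<Longrightarrow> c t \<in> path_image (cr e) - T \<Longrightarrow> pathfinish c \<in> path_image (cr e)"
    "b ` {0<..<1} \<subseteq> c ` {1/2<..<3/4}"
proof -
  note bs = ray_join[OF b(1-3) s(1) b(6,8)]
  have "path_image r \<inter> path_image (b +++ s) \<subseteq> insert q T"
    unfolding bs(2) using rs b(7) by blast
  note rbs = simple_path_two_rays[OF r(1) bs(1) this]
  show im: "path_image c = path_image r \<union> (path_image b \<union> path_image s)"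
    unfolding c_def rbs(2) bs(2) ..
  show start: "pathstart c = pathfinish r" and finish: "pathfinish c = pathfinish s"
    by (simp_all add: c_def)
  have WD: "W \<inter> drawing = {}"
    using f b(5) in_components_subset by blast
  have eD: "path_image (cr e) \<subseteq> drawing" if "e \<in> E" for e
    using that by (auto simp: drawing_def)
  have pq: "q \<in> path_image r" "p \<in> path_image s" "pathfinish s \<in> path_image s"
    using r(1) s(1) pathstart_in_path_image pathfinish_in_path_image unfolding ray_def by metis+
  show early: "pathstart c \<in> path_image (cr e)"
    if e: "e \<in> E" and t: "t \<in> {0..<3/4}" and ct: "c t \<in> path_image (cr e) - T" for e t
  proof (cases "t \<le> 1/2")
    case True
    then have "c t \<in> path_image r"
      using t by (auto simp: c_def joinpaths_def reversepath_def path_image_def)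
    then show ?thesis
      using r(4) e ct unfolding start by blast
  next
    case False
    then have "c t = b (2 * (2 * t - 1))" "2 * (2 * t - 1) \<in> {0<..<1}"
      using t by (auto simp: c_def joinpaths_def)
    then have "c t \<in> W"
      using b(4) by auto
    then show ?thesis
      using ct WD eD[OF e] by blast
  qed
  show late: "pathfinish c \<in> path_image (cr e)"
    if e: "e \<in> E" and t: "t \<in> {1/2<..1}" and ct: "c t \<in> path_image (cr e) - T" for e t
  proof -
    have "c t \<in> W \<or> c t \<in> path_image s"
    proof (cases "2 * t - 1 \<le> 1/2")
      case True
      then have ctb: "c t = b (2 * (2 * t - 1))"
        using t by (auto simp: c_def joinpaths_def)
      show ?thesis
      proof (cases "2 * (2 * t - 1) = 1")
        case True
        then show ?thesis
          using ctb b(3) pq(2) by (simp add: pathfinish_def)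
      next
        case False
        then have "2 * (2 * t - 1) \<in> {0<..<1}"
          using \<open>2 * t - 1 \<le> 1/2\<close> t by auto
        then show ?thesis
          using ctb b(4) by auto
      qed
    next
      case False
      then show ?thesis
        using t by (auto simp: c_def joinpaths_def path_image_def)
    qed
    then have "c t \<in> path_image s"
      using ct WD eD[OF e] by blast
    then have "path_image (cr e) = path_image (cr l)"
      using same_edge[OF e s(2)] ct s(3) by blast
    then show ?thesis
      using s(3) pq(3) unfolding finish by blast
  qed
  show "b ` {0<..<1} \<subseteq> c ` {1/2<..<3/4}"
  proof
    fix z assume "z \<in> b ` {0<..<1}"
    then obtain x where x: "x \<in> {0<..<1}" "z = b x" by blast
    then have "c (1/2 + x/4) = z" "1/2 + x/4 \<in> {1/2<..<3/4}"
      by (auto simp: c_def joinpaths_def)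
    then show "z \<in> c ` {1/2<..<3/4}" by blast
  qed
  have "{0..1} = {0<..<1} \<union> {0, 1::real}" by auto
  then have "path_image b = b ` {0<..<1} \<union> {q, p}"
    using b(2,3) by (simp add: path_image_def pathstart_def pathfinish_def image_Un)
  then have imc: "path_image c \<subseteq> drawing \<union> f"
    unfolding im using b(4,5) r(2) s(3) eD[OF s(2)] pq by blast
  have cT: "path_image c \<inter> T = {pathstart c, pathfinish c}"
    unfolding im start finish using r(1) s(1) b(6) by (auto simp: ray_def)
  have "pathfinish s \<in> V"
  proof -
    have "pathfinish s \<in> path_image (cr l) \<inter> T"
      using s(1,3) pq(3) by (auto simp: ray_def)
    then show ?thesis
      using cr_Int_T[OF s(2)] ends_cr[OF s(2)] by auto
  qed
  moreover have "pathstart c \<in> path_image (cr e) \<or> pathfinish c \<in> path_image (cr e)"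
    if e: "e \<in> E" "(path_image (cr e) - T) \<inter> path_image c \<noteq> {}" for e
  proof -
    obtain z where z: "z \<in> c ` {0..1}" "z \<in> path_image (cr e) - T"
      using e(2) unfolding path_image_def[of c] by blast
    then obtain t where t: "t \<in> {0..1}" "c t \<in> path_image (cr e) - T"
      by blast
    then have "t \<in> {0..<3/4} \<or> t \<in> {1/2<..1}"
      by auto
    then show ?thesis
      using early[OF e(1) _ t(2)] late[OF e(1) _ t(2)] by blast
  qed
  ultimately show "chord_via f c"
    unfolding chord_via_def using f rbs(1) r(3) imc cT by (simp add: c_def)
qed

text \<open>The next crosscut can start from the present one: \<open>W\<close> contains no point of
  the drawing, so near an interior point of \<open>b\<close> the only obstacle is \<open>b\<close>
  itself. The face \<open>f\<close> stays the same.\<close>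

lemma crosscut_descent_state:
  assumes f: "f \<in> components (- drawing)"
    and r: "ray T q r" "path_image r \<subseteq> drawing \<union> f" "pathfinish r \<in> V"
      "\<forall>e\<in>E. (path_image (cr e) - T) \<inter> path_image r \<noteq> {} \<longrightarrow> pathfinish r \<in> path_image (cr e)"
    and s: "ray T p s" "l \<in> E" "path_image s \<subseteq> path_image (cr l)"
    and b: "Path_Connected.arc b" "pathstart b = q" "pathfinish b = p" "b ` {0<..<1} \<subseteq> W"
      "W \<subseteq> f" "path_image b \<inter> T = {}" "path_image b \<inter> path_image r \<subseteq> {q}" "path_image b \<inter> path_image s \<subseteq> {p}"
    and rs: "path_image r \<inter> path_image s \<subseteq> T"
    and W: "open W" "W \<inter> path_image r = {}"
    and R: "R \<in> components (- (T \<union> path_image r \<union> (path_image b \<union> path_image s)))"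
      "path_image (cr l) \<inter> R = {}"
      "\<forall>e\<in>E. path_image (cr e) \<inter> R \<noteq> {} \<longrightarrow> (path_image (cr e) - T) \<inter> path_image r = {}"
  shows "\<exists>c a b W' S. descent_state f c a b R W' S"
proof -
  define c where "c = reversepath r +++ (b +++ s)"
  note cc = crosscut_chord[OF f r s b rs, folded c_def]
  have cT: "path_image c \<inter> T = {pathstart c, pathfinish c}" "simple_path c"
    using cc(1) by (auto simp: chord_via_def)
  have Rc: "R \<in> components (- (T \<union> path_image c))"
    using R(1) by (simp add: cc(2) Un_assoc)
  have WD: "W \<inter> drawing = {}"
    using f b(5) in_components_subset by blast
  have sD: "path_image s \<subseteq> drawing"
    using s(2,3) by (auto simp: drawing_def)
  have pq: "q \<in> path_image r" "p \<in> path_image s"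
    using r(1) s(1) pathstart_in_path_image unfolding ray_def by metis+
  have "{0..1} = {0<..<1} \<union> {0, 1::real}" by auto
  then have b01: "path_image b = b ` {0<..<1} \<union> {q, p}"
    using b(2,3) by (simp add: path_image_def pathstart_def pathfinish_def image_Un)
  have Wc: "W \<inter> (drawing \<union> path_image c) \<subseteq> b ` {0<..<1}"
  proof -
    have "q \<notin> W" "p \<notin> W" "W \<inter> path_image s = {}"
      using WD sD W(2) pq by blast+
    moreover have "path_image c = path_image r \<union> (b ` {0<..<1} \<union> {q, p} \<union> path_image s)"
      unfolding cc(2) by (simp only: b01)
    ultimately show ?thesis
      using WD W(2) by auto
  qed
  define z where "z = b (1/2)"
  have zb: "z \<in> b ` {0<..<1}"
    by (auto simp: z_def)
  then have z: "z \<in> W" "z \<in> path_image c"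
    using b(4) unfolding cc(2) b01 by auto
  then obtain \<rho> where \<rho>: "\<rho> > 0" "ball z \<rho> \<subseteq> W"
    using W(1) open_contains_ball by blast
  define S where "S = ball z \<rho>"
  have S: "S \<inter> (drawing \<union> path_image c) \<subseteq> b ` {0<..<1}" "open S" "connected S" "z \<in> S" "S \<subseteq> W"
    using \<rho> Wc unfolding S_def by auto
  have "S \<inter> (drawing \<union> path_image c) \<subseteq> path_image c"
    using S(1) b01 unfolding cc(2) by blast
  moreover have "z \<in> closure R"
    using chord_subset_closure_region[OF cT(2,1) Rc] z(2) by blast
  ultimately obtain W' where W': "W' \<in> components (- (drawing \<union> path_image c))" "W' \<subseteq> R"
    "S \<inter> frontier W' \<noteq> {}" "W' \<inter> S \<noteq> {}"
    using launch_face[OF Rc S(2,3) _ S(4) z(2)] by blast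
  have "W' \<subseteq> f"
  proof (rule components_maximal[OF f in_components_connected[OF W'(1)]])
    show "W' \<subseteq> - drawing"
      using in_components_subset[OF W'(1)] by blast
    show "f \<inter> W' \<noteq> {}"
      using W'(4) S(5) b(5) by blast
  qed
  have "descent_state f c (1/2) (3/4) R W' S"
    unfolding descent_state_def
  proof (intro conjI ballI impI)
    show "S \<inter> (drawing \<union> path_image c) \<subseteq> c ` {1/2<..<3/4}"
      using S(1) cc(7) by blast
    show "(path_image (cr e) - T) \<inter> path_image c = {}" if e: "e \<in> E" "path_image (cr e) \<inter> R \<noteq> {}" for e
    proof -
      have er: "(path_image (cr e) - T) \<inter> path_image r = {}"
        using R(3) e by blast
      have "path_image (cr e) \<noteq> path_image (cr l)"
        using R(2) e(2) by auto
      then have es: "(path_image (cr e) - T) \<inter> path_image s = {}"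
        using same_edge[OF e(1) s(2)] s(3) by blast
      have "path_image (cr e) \<subseteq> drawing"
        using e(1) by (auto simp: drawing_def)
      then have "path_image (cr e) \<inter> b ` {0<..<1} = {}"
        using b(4) WD by blast
      then show ?thesis
        using er es pq unfolding cc(2) b01 by blast
    qed
  qed (use cc(1,5,6) f Rc W' S \<open>W' \<subseteq> f\<close> in \<open>auto simp: chord_via_def\<close>)
  then show ?thesis by blast
qed

end

section \<open>Heavy regions of chords when no two tree paths balance the faces\<close>

locale unbalanced_drawing = tree_drawing +
  fixes F :: "complex set set"
  assumes F: "finite F" "F \<subseteq> components (- drawing)"
    and unbalanced: "u \<in> V \<Longrightarrow> v \<in> V \<Longrightarrow>
      \<exists>Q. separator u v Q \<and> real (card {f \<in> F. closure f \<inter> Q \<noteq> {}}) > 2 / 3 * real (card F) + 1"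
begin

text \<open>If more than two thirds of the faces plus one are in \<open>H\<close> or equal to
  \<open>f\<close>, then fewer than one third minus one are missed. The face \<open>f\<close> is
  exempt because the chord may cut through it.\<close>

definition heavy :: "complex set \<Rightarrow> complex set \<Rightarrow> bool" where
  "heavy f H \<longleftrightarrow> real (card {g \<in> F - {f}. \<not> g \<subseteq> H}) < real (card F) / 3 - 1"

lemma heavy_mono:
  assumes "heavy {} H"
  shows "heavy f H"
proof -
  have "card {g \<in> F - {f}. \<not> g \<subseteq> H} \<le> card {g \<in> F - {{}}. \<not> g \<subseteq> H}"
    using F in_components_nonempty by (intro card_mono) auto
  then show ?thesis
    using assms by (simp add: heavy_def)
qed

lemma chord_heavy_side:
  assumes c: "chord_via f c"
  obtains H where "H \<in> components (- (T \<union> path_image c))" "heavy f H"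
proof -
  obtain Q where Q: "separator (pathstart c) (pathfinish c) Q"
    and many: "real (card {g \<in> F. closure g \<inter> Q \<noteq> {}}) > 2 / 3 * real (card F) + 1"
    using unbalanced[of "pathstart c" "pathfinish c"] c unfolding chord_via_def by blast
  define A where "A = {g \<in> F. closure g \<inter> Q \<noteq> {}}"
  have A: "A \<subseteq> F" "finite A" "real (card A) > 2 / 3 * real (card F) + 1"
    using F many by (auto simp: A_def)
  \<comment> \<open>Here the summand 1 matters: it forces \<open>card A > 1\<close>, so some touched
    face is not cut by the chord and can determine the side \<open>H\<close>.\<close>
  have "\<not> A \<subseteq> {f}"
  proof
    assume "A \<subseteq> {f}"
    then have "card A \<le> 1"
      using card_mono[of "{f}" A] by simp
    then show False
      using A(3) by (simp add: field_simps)
  qed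
  then obtain g where g: "g \<in> A" "g \<noteq> f" by blast
  then have gc: "g \<in> components (- drawing)"
    using F A by blast
  have "g \<noteq> {}" "connected g"
    using gc in_components_nonempty in_components_connected by blast+
  have "g \<inter> f = {}"
    using gc g c components_nonoverlap by (auto simp: chord_via_def)
  then have "g \<subseteq> - (T \<union> path_image c)"
    using in_components_subset[OF gc] c T_subset_drawing unfolding chord_via_def by blast
  then obtain H where H: "H \<in> components (- (T \<union> path_image c))" "g \<subseteq> H"
    using exists_component_superset[OF _ _ \<open>connected g\<close>] \<open>g \<noteq> {}\<close> by (metis subset_empty)
  have "h \<subseteq> H" if "h \<in> A" "h \<noteq> f" for h
    using touched_faces_same_side[OF c Q gc g(2) _ _ that(2) _ H] g(1) that(1) F by (auto simp: A_def)
  then have "{h \<in> F - {f}. \<not> h \<subseteq> H} \<subseteq> F - A"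
    by blast
  then have "card {h \<in> F - {f}. \<not> h \<subseteq> H} \<le> card F - card A"
    using card_mono[of "F - A"] F A by (metis card_Diff_subset finite_Diff)
  moreover have "card A \<le> card F"
    using A F by (simp add: card_mono)
  ultimately have "heavy f H"
    unfolding heavy_def using A(3) by (simp add: of_nat_diff field_simps)
  then show ?thesis
    using that H by blast
qed

text \<open>Together the three regions miss fewer than \<open>card F - 3\<close> faces, while at
  least \<open>card F - 1\<close> faces differ from \<open>f\<close>. Applied to three copies of one
  region, it shows that a heavy region contains a face other than \<open>f\<close>.\<close>

lemma heavy_regions_meet:
  assumes "heavy f A" "heavy f B" "heavy f C"
  obtains g where "g \<in> F" "g \<noteq> f" "g \<subseteq> A" "g \<subseteq> B" "g \<subseteq> C"
proof (rule ccontr)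
  let ?M = "\<lambda>H. {g \<in> F - {f}. \<not> g \<subseteq> H}"
  assume "\<not> thesis"
  then have "F - {f} \<subseteq> ?M A \<union> ?M B \<union> ?M C"
    using that by blast
  then have "card (F - {f}) \<le> card (?M A \<union> ?M B \<union> ?M C)"
    using F by (intro card_mono) auto
  also have "\<dots> \<le> card (?M A) + card (?M B) + card (?M C)"
    by (meson add_mono card_Un_le order_refl order_trans)
  finally have "real (card (F - {f})) \<le> real (card (?M A)) + real (card (?M B)) + real (card (?M C))"
    by linarith
  moreover have "real (card F) - 1 \<le> real (card (F - {f}))"
    by (cases "f \<in> F") (use F in \<open>auto simp: card_Diff_singleton\<close>)
  ultimately show False
    using assms unfolding heavy_def by linarith
qed

end

section \<open>Crosscuts from a chord to a non-tree edge\<close>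

context tree_drawing
begin

lemma descent_stateD:
  assumes "descent_state f c a b H W S"
  shows "f \<in> components (- drawing)" "H \<in> components (- (T \<union> path_image c))"
    "W \<in> components (- (drawing \<union> path_image c))" "W \<subseteq> H" "W \<subseteq> f"
    "open S" "S \<inter> frontier W \<noteq> {}" "S \<inter> (drawing \<union> path_image c) \<subseteq> c ` {a<..<b}"
    "simple_path c" "path_image c \<inter> T = {pathstart c, pathfinish c}"
    "pathstart c \<in> V" "pathfinish c \<in> V" "path_image c \<subseteq> drawing \<union> f" "0 \<le> a" "b \<le> 1"
    "\<forall>e\<in>E. \<forall>s\<in>{0..<b}. c s \<in> path_image (cr e) - T \<longrightarrow> pathstart c \<in> path_image (cr e)"
    "\<forall>e\<in>E. \<forall>s\<in>{a<..1}. c s \<in> path_image (cr e) - T \<longrightarrow> pathfinish c \<in> path_image (cr e)"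
    "\<forall>e\<in>E. path_image (cr e) \<inter> H \<noteq> {} \<longrightarrow> (path_image (cr e) - T) \<inter> path_image c = {}"
  using assms unfolding descent_state_def by - (elim conjE, assumption)+

text \<open>The face \<open>g\<close> keeps \<open>W\<close> from filling \<open>H\<close>, so
  \<open>W\<close> has a frontier point inside \<open>H\<close>, necessarily on a non-tree edge
  \<open>l\<close>. Pairs of frontier points that are joined by an arc through \<open>W\<close> are
  dense, so one such arc leads from the admissible stretch of the chord to the interior of
  \<open>l\<close>.\<close>

lemma crosscut_to_edge:
  assumes st: "descent_state f c a b H W S" and g: "g \<in> components (- drawing)" "g \<noteq> f" "g \<subseteq> H"
  obtains l d t s where "l \<in> E" "path_image (cr l) \<inter> H \<noteq> {}"
    "Path_Connected.arc d" "d ` {0<..<1} \<subseteq> W"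
    "pathstart d = c t" "a < t" "t < b" "pathfinish d = cr l s" "0 < s" "s < 1" "cr l s \<in> H"
proof -
  note st' = descent_stateD[OF st]
  note f = st'(1) and H = st'(2) and W = st'(3-5) and S = st'(6-8) and c = st'(9) and avoid = st'(18)
  have closed: "closed (drawing \<union> path_image c)"
    using closed_drawing c closed_simple_path_image by blast
  have fr: "frontier W \<subseteq> drawing \<union> path_image c"
    using frontier_of_components_closed_complement[OF closed W(1)] .
  have oW: "open W" "connected W" "W \<noteq> {}"
    using W(1) closed open_components in_components_connected in_components_nonempty by blast+
  have "frontier W \<inter> H \<noteq> {}"
  proof
    assume "frontier W \<inter> H = {}"
    then have "H \<subseteq> W"
      using in_components_connected[OF H] W(2) oW(3) by (intro subset_of_side) auto
    then have "g \<subseteq> f"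
      using g(3) W(3) by blast
    then show False
      using g f components_nonoverlap in_components_nonempty by (metis Int_absorb2)
  qed
  then obtain z where z: "z \<in> frontier W" "z \<in> H"
    by blast
  then have "z \<notin> T" "z \<notin> path_image c"
    using in_components_subset[OF H] by blast+
  then obtain l where l: "l \<in> E" "z \<in> path_image (cr l) - T"
    using z fr unfolding drawing_def by blast
  then have lH: "path_image (cr l) \<inter> H \<noteq> {}"
    using z by blast
  have lc: "(path_image (cr l) - T) \<inter> path_image c = {}"
    using avoid l(1) lH by blast
  then have int_H: "path_image (cr l) - T \<subseteq> H"
    using components_maximal[OF H edge_interior(2)[OF l(1)]] l(2) z(2) by blast
  \<comment> \<open>An open set around \<open>z\<close> in which \<open>l\<close> is the only part
    of the drawing. Being disjoint from the chord, it also makes the two relatively open parts of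
    the frontier distinct, as the accessibility theorem demands.\<close>
  define B where "B = - (other_edges l \<union> path_image c)"
  have oB: "open B"
    unfolding B_def using closed_other_edges c closed_simple_path_image by (intro open_Compl closed_Un)
  have "z \<notin> other_edges l"
    using drawing_minus_other_edges[OF l(1)] l(2) by blast
  then have zB: "z \<in> B"
    using l(2) lc unfolding B_def by blast
  have frB: "frontier W \<inter> B \<subseteq> path_image (cr l) - T"
    using fr drawing_minus_other_edges[OF l(1)] unfolding B_def by blast
  have frS: "frontier W \<inter> S \<subseteq> c ` {a<..<b}"
    using fr S(3) by blast
  have ab: "0 \<le> a" "b \<le> 1"
    using st'(14,15) by blast+
  have "frontier W \<inter> S \<subseteq> path_image c"
    using frS ab by (auto simp: path_image_def)
  then have "frontier W \<inter> S \<noteq> frontier W \<inter> B"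
    using S(2) unfolding B_def by blast
  then obtain d where d: "Path_Connected.arc d" "pathstart d \<in> frontier W \<inter> S"
    "pathfinish d \<in> frontier W \<inter> B" "d ` {0<..<1} \<subseteq> W"
    using dense_accessible_frontier_point_pairs[OF oW(1,2), of "frontier W \<inter> S" "frontier W \<inter> B"]
      S(1,2) oB zB z(1) openin_open_Int by blast
  obtain t where t: "pathstart d = c t" "a < t" "t < b"
    using d(2) frS by auto
  obtain s where s: "pathfinish d = cr l s" "0 < s" "s < 1"
    using d(3) frB edge_interior(1)[OF l(1)] by auto
  have "cr l s \<in> H"
    using d(3) frB int_H unfolding s(1) by blast
  then show ?thesis
    using that l lH d t s by blast
qed

end

section \<open>Descent to a heavy region with fewer edges\<close>

context unbalanced_drawing
begin

definition potential :: "complex set \<Rightarrow> nat" where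
  "potential H = card {e \<in> E. path_image (cr e) \<inter> H \<noteq> {}}"

lemma potential_less:
  assumes "H' \<subseteq> H" "l \<in> E" "path_image (cr l) \<inter> H \<noteq> {}" "path_image (cr l) \<inter> H' = {}"
  shows "potential H' < potential H"
  unfolding potential_def using assms finite_E by (intro psubset_card_mono) auto

text \<open>Suppose that none of \<open>R\<close>, \<open>U\<close>, \<open>Q\<close> is heavy.
  Their chords still have heavy sides \<open>R1\<close>, \<open>U1\<close>, \<open>Q1\<close>,
  opposite to them. The heavy side of the chord made of \<open>r\<close>, \<open>b\<close> and
  \<open>s'\<close> must be \<open>Z\<close>: otherwise a face common to it, \<open>H\<close> and
  \<open>R1\<close> would miss both \<open>Z\<close> and \<open>R\<close>, which fill
  \<open>H\<close> up to curves. Then a face common to \<open>Z\<close>, \<open>U1\<close> and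
  \<open>Q1\<close> misses \<open>U\<close> and \<open>Q\<close>, which fill \<open>Z\<close> up to
  a curve.\<close>

lemma descend_through_regions:
  assumes f: "f \<in> components (- drawing)"
    and r: "ray T q r" "ray T q r'" "path_image r \<subseteq> drawing \<union> f" "path_image r' \<subseteq> drawing \<union> f"
      "pathfinish r \<in> V" "pathfinish r' \<in> V"
      "\<forall>e\<in>E. (path_image (cr e) - T) \<inter> path_image r \<noteq> {} \<longrightarrow> pathfinish r \<in> path_image (cr e)"
      "\<forall>e\<in>E. (path_image (cr e) - T) \<inter> path_image r' \<noteq> {} \<longrightarrow> pathfinish r' \<in> path_image (cr e)"
    and l: "l \<in> E" "ray T p s" "ray T p s'" "path_image s \<union> path_image s' = path_image (cr l)"
    and b: "Path_Connected.arc b" "pathstart b = q" "pathfinish b = p" "b ` {0<..<1} \<subseteq> W"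
      "W \<subseteq> f" "path_image b \<inter> T = {}" "path_image b \<inter> (path_image r \<union> path_image r') \<subseteq> {q}"
      "path_image b \<inter> path_image (cr l) \<subseteq> {p}"
    and rl: "(path_image r \<union> path_image r') \<inter> path_image (cr l) \<subseteq> T"
    and W: "open W" "W \<inter> (path_image r \<union> path_image r') = {}"
    and H: "path_image (cr l) \<inter> H \<noteq> {}"
      "\<forall>e\<in>E. path_image (cr e) \<inter> H \<noteq> {} \<longrightarrow> (path_image (cr e) - T) \<inter> (path_image r \<union> path_image r') = {}"
    and heavy_H: "heavy f H"
    and reg: "crosscut_regions T r r' b s s' H Z R U Q"
  shows "\<exists>f' c' a' b' H' W' S'. descent_state f' c' a' b' H' W' S' \<and> heavy f' H' \<and>
    potential H' < potential H"
proof -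
  have Z: "Z \<in> components (- (T \<union> path_image r \<union> (path_image b \<union> path_image s')))"
    and R: "R \<in> components (- (T \<union> path_image r' \<union> (path_image b \<union> path_image s')))"
      "R \<subseteq> H" "R \<inter> path_image s = {}"
    and U: "U \<in> components (- (T \<union> path_image r \<union> (path_image b \<union> path_image s)))"
      "U \<subseteq> H" "U \<inter> path_image s' = {}"
    and Q: "Q \<in> components (- (T \<union> path_image s \<union> path_image s'))" "Q \<subseteq> H"
    and ZR: "H - (path_image b \<union> path_image s') \<subseteq> Z \<union> R"
    and UQ: "Z - path_image s \<subseteq> U \<union> Q"
    using reg unfolding crosscut_regions_def by blast+
  have sl: "path_image s \<subseteq> path_image (cr l)" "path_image s' \<subseteq> path_image (cr l)"
    using l(4) by blast+
  have br: "path_image b \<inter> path_image r \<subseteq> {q}" "path_image b \<inter> path_image r' \<subseteq> {q}"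
    "path_image b \<inter> path_image s \<subseteq> {p}" "path_image b \<inter> path_image s' \<subseteq> {p}"
    "path_image r \<inter> path_image s \<subseteq> T" "path_image r \<inter> path_image s' \<subseteq> T"
    "path_image r' \<inter> path_image s' \<subseteq> T"
    "W \<inter> path_image r = {}" "W \<inter> path_image r' = {}"
    using b(7,8) sl rl W(2) by blast+
  have f_or: "path_image b \<subseteq> drawing \<union> f"
  proof -
    have "{0..1} = {0<..<1} \<union> {0, 1::real}" by auto
    then have "path_image b = b ` {0<..<1} \<union> {q, p}"
      using b(2,3) by (simp add: path_image_def pathstart_def pathfinish_def image_Un)
    moreover have "q \<in> path_image r" "p \<in> path_image s"
      using r(1) l(2) pathstart_in_path_image unfolding ray_def by metis+
    moreover have "path_image (cr l) \<subseteq> drawing"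
      using l(1) by (auto simp: drawing_def)
    ultimately show ?thesis
      using r(3) b(4,5) sl(1) by blast
  qed
  \<comment> \<open>The edge \<open>l\<close> is used up: each of its two rays is part of the chord
    that bounds the smaller region or is disjoint from that region. So the region meets fewer edges
    than \<open>H\<close>.\<close>
  have R_empty: "path_image (cr l) \<inter> R = {}"
    using R(3) in_components_subset[OF R(1)] l(4) by blast
  have U_empty: "path_image (cr l) \<inter> U = {}"
    using U(3) in_components_subset[OF U(1)] l(4) by blast
  have Q': "Q \<in> components (- (T \<union> path_image (cr l)))"
    using Q(1) l(4) by (simp add: Un_assoc)
  then have Q_empty: "path_image (cr l) \<inter> Q = {}"
    using in_components_subset by blast
  note chord_rs' = crosscut_chord[OF f r(1,3,5,7) l(3,1) sl(2) b(1-6) br(1,4,6)]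
  note chord_r's' = crosscut_chord[OF f r(2,4,6,8) l(3,1) sl(2) b(1-6) br(2,4,7)]
  note chord_rs = crosscut_chord[OF f r(1,3,5,7) l(2,1) sl(1) b(1-6) br(1,3,5)]
  \<comment> \<open>The regions fill \<open>H\<close> and \<open>Z\<close> only up to the crosscut
    and the edge. These curves lie in the drawing and \<open>f\<close>, so every face other than
    \<open>f\<close> has a point off them.\<close>
  have point: "\<exists>x\<in>g. x \<notin> path_image b \<union> path_image s \<union> path_image s'"
    if g: "g \<in> F" "g \<noteq> f" for g
  proof -
    have g': "g \<in> components (- drawing)"
      using g F by blast
    then have "g \<inter> f = {}"
      using g(2) f components_nonoverlap by metis
    then obtain x where x: "x \<in> g" "x \<notin> drawing" "x \<notin> f"
      using in_components_nonempty[OF g'] in_components_subset[OF g'] by blast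
    moreover have "path_image (cr l) \<subseteq> drawing"
      using l(1) by (auto simp: drawing_def)
    ultimately show ?thesis
      using f_or sl by blast
  qed
  show ?thesis
  proof (cases "heavy f R \<or> heavy f U \<or> heavy {} Q")
    case True
    then consider "heavy f R" | "heavy f U" | "heavy {} Q" by blast
    then show ?thesis
    proof cases
      case 1
      have "\<forall>e\<in>E. path_image (cr e) \<inter> R \<noteq> {} \<longrightarrow> (path_image (cr e) - T) \<inter> path_image r' = {}"
        using H(2) R(2) by blast
      then obtain c' a' b' W' S' where "descent_state f c' a' b' R W' S'"
        using crosscut_descent_state[OF f r(2,4,6,8) l(3,1) sl(2) b(1-6) br(2,4,7) W(1) br(9) R(1) R_empty]
        by blast
      then show ?thesis
        using 1 potential_less[OF R(2) l(1) H(1) R_empty] by blast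
    next
      case 2
      have "\<forall>e\<in>E. path_image (cr e) \<inter> U \<noteq> {} \<longrightarrow> (path_image (cr e) - T) \<inter> path_image r = {}"
        using H(2) U(2) by blast
      then obtain c' a' b' W' S' where "descent_state f c' a' b' U W' S'"
        using crosscut_descent_state[OF f r(1,3,5,7) l(2,1) sl(1) b(1-6) br(1,3,5) W(1) br(8) U(1) U_empty]
        by blast
      then show ?thesis
        using 2 potential_less[OF U(2) l(1) H(1) U_empty] by blast
    next
      case 3
      \<comment> \<open>The new chord is an edge, and its face \<open>f'\<close> is chosen only now;
        heaviness without an exempt face carries over to every choice.\<close>
      obtain f' W' S' where "descent_state f' (cr l) 0 1 Q W' S'"
        using edge_descent_state[OF l(1) Q'] by blast
      then show ?thesis
        using heavy_mono[OF 3, of f'] potential_less[OF Q(2) l(1) H(1) Q_empty] by blast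
    qed
  next
    case False
    have disj: "A \<inter> B = {}" if "A \<in> components X" "B \<in> components X" "A \<noteq> B" for A B X :: "complex set"
      using that components_nonoverlap by blast
    obtain R1 where R1: "R1 \<in> components (- (T \<union> path_image r' \<union> (path_image b \<union> path_image s')))" "heavy f R1"
      using chord_heavy_side[OF chord_r's'(1)] unfolding chord_r's'(2) Un_assoc by metis
    obtain Z1 where Z1: "Z1 \<in> components (- (T \<union> path_image r \<union> (path_image b \<union> path_image s')))" "heavy f Z1"
      using chord_heavy_side[OF chord_rs'(1)] unfolding chord_rs'(2) Un_assoc by metis
    obtain U1 where U1: "U1 \<in> components (- (T \<union> path_image r \<union> (path_image b \<union> path_image s)))" "heavy f U1"
      using chord_heavy_side[OF chord_rs(1)] unfolding chord_rs(2) Un_assoc by metis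
    obtain Q1 where Q1: "Q1 \<in> components (- (T \<union> path_image (cr l)))" "heavy {} Q1"
      using chord_heavy_side[OF chord_via_edge[OF l(1)]] by metis
    have R1R: "R1 \<inter> R = {}" and U1U: "U1 \<inter> U = {}" and Q1Q: "Q1 \<inter> Q = {}"
      using disj[OF R1(1) R(1)] disj[OF U1(1) U(1)] disj[OF Q1(1) Q'] R1 U1 Q1 False by blast+
    have "Z1 = Z"
    proof (rule ccontr)
      assume "Z1 \<noteq> Z"
      then have "Z1 \<inter> Z = {}"
        using disj[OF Z1(1) Z] by blast
      obtain g where g: "g \<in> F" "g \<noteq> f" "g \<subseteq> H" "g \<subseteq> Z1" "g \<subseteq> R1"
        using heavy_regions_meet[OF heavy_H Z1(2) R1(2)] by metis
      then obtain x where "x \<in> g" "x \<notin> path_image b \<union> path_image s \<union> path_image s'"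
        using point by blast
      then show False
        using g ZR \<open>Z1 \<inter> Z = {}\<close> R1R by blast
    qed
    obtain g where g: "g \<in> F" "g \<noteq> f" "g \<subseteq> Z" "g \<subseteq> U1" "g \<subseteq> Q1"
      using heavy_regions_meet[OF _ U1(2) heavy_mono[OF Q1(2)]] Z1(2) \<open>Z1 = Z\<close> by metis
    then obtain x where "x \<in> g" "x \<notin> path_image b \<union> path_image s \<union> path_image s'"
      using point by blast
    then show ?thesis
      using g UQ U1U Q1Q by blast
  qed
qed

lemma descent_step:
  assumes st: "descent_state f c a b H W S" and heavy_H: "heavy f H"
  shows "\<exists>f' c' a' b' H' W' S'. descent_state f' c' a' b' H' W' S' \<and> heavy f' H' \<and>
    potential H' < potential H"
proof -
  note st' = descent_stateD[OF st]
  note f = st'(1) and H = st'(2) and W = st'(3-5) and c = st'(9-13) and ab = st'(14,15)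
    and early = st'(16) and late = st'(17) and avoid = st'(18)
  obtain g where "g \<in> F" "g \<noteq> f" "g \<subseteq> H"
    using heavy_regions_meet[OF heavy_H heavy_H heavy_H] by metis
  moreover from this have "g \<in> components (- drawing)"
    using F by blast
  ultimately obtain l d t s where l: "l \<in> E" "path_image (cr l) \<inter> H \<noteq> {}"
    and d: "Path_Connected.arc d" "d ` {0<..<1} \<subseteq> W" "pathstart d = c t" "pathfinish d = cr l s"
    and t: "a < t" "t < b" and s: "0 < s" "s < 1" "cr l s \<in> H"
    using crosscut_to_edge[OF st] by metis
  have t01: "0 < t" "t < 1"
    using t ab by auto
  have l_arc: "simple_path (cr l)" "path_image (cr l) \<inter> T = {pathstart (cr l), pathfinish (cr l)}"
    using arc_cr cr_Int_T l(1) arc_imp_simple_path by blast+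
  define r r' where "r = subpath t 0 c" and "r' = subpath t 1 c"
  define \<sigma> \<sigma>' where "\<sigma> = subpath s 0 (cr l)" and "\<sigma>' = subpath s 1 (cr l)"
  note r = rays_of_chord[OF c(1,2) t01, folded r_def r'_def]
  note \<sigma> = rays_of_chord[OF l_arc s(1,2), folded \<sigma>_def \<sigma>'_def]
  have finish: "pathfinish r = pathstart c" "pathfinish r' = pathfinish c"
    by (simp_all add: r_def r'_def pathstart_def pathfinish_def subpath_def)
  have lc: "(path_image (cr l) - T) \<inter> path_image c = {}"
    using avoid l by blast
  have rl: "(path_image r \<union> path_image r') \<inter> path_image (cr l) \<subseteq> T"
    using lc unfolding r(3) by blast
  have "{0..1} = {0<..<1} \<union> {0, 1::real}" by auto
  then have d01: "path_image d = d ` {0<..<1} \<union> {c t, cr l s}"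
    using d(3,4) by (simp add: path_image_def pathstart_def pathfinish_def image_Un)
  have WD: "W \<inter> (drawing \<union> path_image c) = {}"
    using in_components_subset[OF W(1)] by blast
  have lD: "path_image (cr l) \<subseteq> drawing"
    using l(1) by (auto simp: drawing_def)
  have ct: "c t \<in> path_image c" "c t \<notin> T" and cs: "cr l s \<in> path_image (cr l)" "cr l s \<notin> T"
    using r(1) \<sigma>(1) t01 s(1,2) by (auto simp: ray_def path_image_def)
  have ctl: "c t \<notin> path_image (cr l)" and csc: "cr l s \<notin> path_image c"
    using lc ct cs by blast+
  have dT: "path_image d \<inter> T = {}"
    using d(2) WD T_subset_drawing ct cs unfolding d01 by blast
  have dc: "path_image d \<inter> (path_image r \<union> path_image r') \<subseteq> {c t}"
    using d(2) WD csc unfolding r(3) d01 by blast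
  have dl: "path_image d \<inter> path_image (cr l) \<subseteq> {cr l s}"
    using d(2) WD lD ctl unfolding d01 by blast
  have rD: "path_image r \<subseteq> drawing \<union> f" "path_image r' \<subseteq> drawing \<union> f"
    using c(5) r(3) by blast+
  \<comment> \<open>As \<open>t\<close> lies strictly between \<open>a\<close> and \<open>b\<close>,
    the half up to \<open>t\<close> meets only interiors of edges at the start of the chord, and the
    half from \<open>t\<close> only those at its finish.\<close>
  have incr: "\<forall>e\<in>E. (path_image (cr e) - T) \<inter> path_image r \<noteq> {} \<longrightarrow> pathfinish r \<in> path_image (cr e)"
  proof (intro ballI impI)
    fix e assume e: "e \<in> E" "(path_image (cr e) - T) \<inter> path_image r \<noteq> {}"
    obtain x where "x \<in> {0..t}" "c x \<in> path_image (cr e) - T"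
      using e(2) unfolding r(5) by blast
    then show "pathfinish r \<in> path_image (cr e)"
      using early e(1) t(2) finish(1) by auto
  qed
  have incr': "\<forall>e\<in>E. (path_image (cr e) - T) \<inter> path_image r' \<noteq> {} \<longrightarrow> pathfinish r' \<in> path_image (cr e)"
  proof (intro ballI impI)
    fix e assume e: "e \<in> E" "(path_image (cr e) - T) \<inter> path_image r' \<noteq> {}"
    obtain x where "x \<in> {t..1}" "c x \<in> path_image (cr e) - T"
      using e(2) unfolding r(6) by blast
    then show "pathfinish r' \<in> path_image (cr e)"
      using late e(1) t(1) finish(2) by auto
  qed
  have "closed (drawing \<union> path_image c)"
    using closed_drawing closed_simple_path_image[OF c(1)] by blast
  then have oW: "open W"
    using open_components[OF _ W(1)] by blast
  have Wr: "W \<inter> (path_image r \<union> path_image r') = {}"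
    using WD unfolding r(3) by blast
  have avoid': "\<forall>e\<in>E. path_image (cr e) \<inter> H \<noteq> {} \<longrightarrow> (path_image (cr e) - T) \<inter> (path_image r \<union> path_image r') = {}"
    using avoid unfolding r(3) by blast
  have H': "H \<in> components (- (T \<union> path_image r \<union> path_image r'))"
    using H by (simp add: Un_assoc r(3))
  have V: "pathfinish r \<in> V" "pathfinish r' \<in> V"
    using c finish by simp_all
  have sym: "path_image r' \<union> path_image r = path_image r \<union> path_image r'"
    by blast
  obtain Z R U Q where "crosscut_regions T r r' d \<sigma> \<sigma>' H Z R U Q \<or> crosscut_regions T r' r d \<sigma> \<sigma>' H Z R U Q"
    using crosscut_regions_exist[OF T r(1,2,4) \<sigma>(1,2,4) rl[folded \<sigma>(3)] d(1,3,4) dT dc dl[folded \<sigma>(3)] H' s(3)]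
    by blast
  then show ?thesis
  proof
    assume "crosscut_regions T r r' d \<sigma> \<sigma>' H Z R U Q"
    then show ?thesis
      using descend_through_regions[OF f r(1,2) rD V incr incr' l(1) \<sigma>(1-3) d(1,3,4,2) W(3) dT dc dl rl oW Wr
          l(2) avoid' heavy_H] by blast
  next
    assume "crosscut_regions T r' r d \<sigma> \<sigma>' H Z R U Q"
    then show ?thesis
      using descend_through_regions[OF f r(2,1) rD(2,1) V(2,1) incr' incr l(1) \<sigma>(1-3) d(1,3,4,2) W(3) dT,
          unfolded sym, OF dc dl rl oW Wr l(2) avoid' heavy_H] by blast
  qed
qed

lemma no_descent_state: "descent_state f c a b H W S \<Longrightarrow> heavy f H \<Longrightarrow> False"
proof (induction "potential H" arbitrary: f c a b H W S rule: less_induct)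
  case less
  then show ?case
    using descent_step[OF less.prems] by metis
qed

lemma unbalanced_drawing_False: False
proof (cases "E = {}")
  \<comment> \<open>Without non-tree edges the only face is \<open>- T\<close>, so \<open>F\<close>
    is too small for the assumed excess.\<close>
  case True
  obtain u Q where "real (card {f \<in> F. closure f \<inter> Q \<noteq> {}}) > 2 / 3 * real (card F) + 1"
    using unbalanced V_nonempty by (metis ex_in_conv)
  moreover have "card {f \<in> F. closure f \<inter> Q \<noteq> {}} \<le> card F"
    using F by (intro card_mono) auto
  moreover have "drawing = T"
    unfolding drawing_def using True by simp
  then have "components (- drawing) \<subseteq> {- T}"
    using T(3) by (simp add: connected_eq_components_subset_sing)
  then have "card F \<le> 1"
    using F card_mono[of "{- T}" F] by auto
  ultimately show False
    by linarith
next
  case False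
  then obtain e where e: "e \<in> E" by blast
  obtain H where H: "H \<in> components (- (T \<union> path_image (cr e)))" "heavy {} H"
    using chord_heavy_side[OF chord_via_edge[OF e]] by blast
  obtain f W S where "descent_state f (cr e) 0 1 H W S"
    using edge_descent_state[OF e H(1)] by blast
  then show False
    using no_descent_state heavy_mono[OF H(2)] by blast
qed

end

theorem (in tree_drawing) balanced_separator:
  assumes "finite F" "F \<subseteq> components (- drawing)"
  shows "\<exists>u\<in>V. \<exists>v\<in>V. \<forall>Q. separator u v Q \<longrightarrow>
    real (card {f \<in> F. closure f \<inter> Q \<noteq> {}}) \<le> 2 / 3 * real (card F) + 1"
proof (rule ccontr)
  assume "\<not> ?thesis"
  then have "unbalanced_drawing T V P E cr F"
    using assms by unfold_locales (force simp: not_le)+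
  then show False
    by (rule unbalanced_drawing.unbalanced_drawing_False)
qed

section \<open>Finitely many faces\<close>

text \<open>Janiszewski's theorem identifies each component of the complement of the union with the
  intersection of a component of \<open>- S\<close> and one of \<open>- T\<close>, so there are at
  most as many as there are pairs.\<close>

lemma finite_components_Un:
  fixes S :: "complex set"
  assumes ST: "compact S" "closed T" "connected (S \<inter> T)"
    and fin: "finite (components (- S))" "finite (components (- T))"
  shows "finite (components (- (S \<union> T)))"
proof -
  have "components (- (S \<union> T)) \<subseteq> (\<lambda>(A, B). A \<inter> B) ` (components (- S) \<times> components (- T))"
  proof
    fix C assume C: "C \<in> components (- (S \<union> T))"
    have con: "connected C" "C \<noteq> {}" "C \<subseteq> - S" "C \<subseteq> - T"
      using in_components_connected[OF C] in_components_nonempty[OF C] in_components_subset[OF C] by auto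
    obtain A where A: "A \<in> components (- S)" "C \<subseteq> A"
      using exists_component_superset[OF con(3) _ con(1)] con(2,3) by blast
    obtain B where B: "B \<in> components (- T)" "C \<subseteq> B"
      using exists_component_superset[OF con(4) _ con(1)] con(2,4) by blast
    have "A \<inter> B \<subseteq> C"
    proof
      fix y assume y: "y \<in> A \<inter> B"
      obtain x where x: "x \<in> C" using con by blast
      have "connected_component (- S) x y" "connected_component (- T) x y"
        unfolding connected_component_def
        using A B x y in_components_connected in_components_subset by blast+
      then have "connected_component (- (S \<union> T)) x y"
        using Janiszewski[OF ST] by blast
      then obtain Q where "connected Q" "Q \<subseteq> - (S \<union> T)" "x \<in> Q" "y \<in> Q"
        unfolding connected_component_def by blast
      then show "y \<in> C"
        using components_maximal[OF C] x by blast
    qed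
    then have "C = A \<inter> B"
      using A(2) B(2) by blast
    then show "C \<in> (\<lambda>(A, B). A \<inter> B) ` (components (- S) \<times> components (- T))"
      using A(1) B(1) by force
  qed
  then show ?thesis
    using fin by (meson finite_SigmaI finite_imageI finite_subset)
qed

lemma disjoint_family_insert:
  assumes "disjoint (insert D \<D>)" "D \<notin> \<D>"
  shows "D \<inter> \<Union>\<D> = {}" "disjoint \<D>"
proof -
  show "disjoint \<D>"
    using assms(1) by (simp add: pairwise_insert)
  show "D \<inter> \<Union>\<D> = {}"
    using assms by (auto simp: pairwise_insert disjnt_def)
qed

lemma finite_components_Union:
  fixes \<D> :: "complex set set"
  assumes "finite \<D>" "disjoint \<D>" "\<And>D. D \<in> \<D> \<Longrightarrow> compact D \<and> finite (components (- D))"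
  shows "finite (components (- \<Union>\<D>))"
  using assms
proof (induction \<D>)
  case empty
  have "components (UNIV :: complex set) = {UNIV}"
    by (simp add: components_eq_sing_iff)
  then show ?case by simp
next
  case (insert D \<D>)
  note d = disjoint_family_insert[OF insert.prems(1) insert.hyps(2)]
  have "compact (\<Union>\<D>)"
    using insert by (intro compact_Union) auto
  then show ?case
    using insert d finite_components_Un[of D "\<Union>\<D>"] by (simp add: compact_imp_closed)
qed

text \<open>The name refers to the contrapositive: finitely many disjoint compact sets separate two
  points only if one of them does. Each step of the induction is Janiszewski's theorem with an empty
  intersection.\<close>

lemma separated_by_member:
  fixes \<D> :: "complex set set"
  assumes "finite \<D>" "disjoint \<D>"
    "\<And>D. D \<in> \<D> \<Longrightarrow> compact D \<and> connected_component (- D) x y"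
  shows "connected_component (- \<Union>\<D>) x y"
  using assms
proof (induction \<D>)
  case empty
  have "connected_component UNIV x y"
    unfolding connected_component_def by (intro exI[of _ UNIV]) (simp add: convex_connected)
  then show ?case by simp
next
  case (insert D \<D>)
  note d = disjoint_family_insert[OF insert.prems(1) insert.hyps(2)]
  have "compact (\<Union>\<D>)"
    using insert by (intro compact_Union) auto
  then show ?case
    using insert d Janiszewski[of D "\<Union>\<D>" x y] by (simp add: compact_imp_closed)
qed

text \<open>Edges are added one at a time. The tree with a single edge leaves two regions, and it
  meets the part already drawn exactly in the connected set \<open>T\<close>.\<close>

lemma (in tree_drawing) finite_components_drawing: "finite (components (- drawing))"
proof -
  define dr where "dr E' = T \<union> (\<Union>e\<in>E'. path_image (cr e))" for E'
  have "finite (components (- dr E'))" if "finite E'" "E' \<subseteq> E" for E'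
    using that
  proof (induction E')
    case empty
    then show ?case
      using T(3) connected_eq_components_subset_sing[of "- T"] finite_subset by (auto simp: dr_def)
  next
    case (insert e E')
    have e: "e \<in> E" "E' \<subseteq> E" "finite E'"
      using insert by auto
    have fin: "finite (components (- dr E'))"
      using insert by auto
    show ?case
    proof (cases "path_image (cr e) \<subseteq> dr E'")
      \<comment> \<open>An arc with the same curve, such as the opposite arc, is already
        drawn.\<close>
      case True
      then have "dr (insert e E') = dr E'"
        by (auto simp: dr_def)
      then show ?thesis
        using fin by simp
    next
      case False
      have sp: "simple_path (cr e)"
        using arc_cr e arc_imp_simple_path by blast
      note r = rays_of_chord[OF sp cr_Int_T[OF e(1)], of "1/2", simplified]
      obtain U1 U2 where "components (- (T \<union> path_image (subpath (1/2) 0 (cr e)) \<union> path_image (subpath (1/2) 1 (cr e)))) = {U1, U2}"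
        using components_two_rays[OF T r(1,2,4)] by metis
      then have "finite (components (- (T \<union> path_image (cr e))))"
        by (simp add: Un_assoc r(3))
      moreover have "(T \<union> path_image (cr e)) \<inter> dr E' = T"
        using False cr_Int_cr[OF e(1)] e(2) unfolding dr_def by blast
      moreover have "compact (T \<union> path_image (cr e))"
        using T(1) arc_cr[OF e(1)] compact_arc_image by blast
      moreover have "closed (dr E')"
        unfolding dr_def using e arc_cr closed_T
        by (intro closed_Un closed_UN) (auto simp: closed_arc_image)
      moreover have "dr (insert e E') = (T \<union> path_image (cr e)) \<union> dr E'"
        by (auto simp: dr_def)
      ultimately show ?thesis
        using finite_components_Un fin T(2) path_connected_imp_connected by metis
    qed
  qed
  then show ?thesis
    using finite_E by (simp add: drawing_def dr_def)
qed

text \<open>A disc stays connected when a point is removed, whereas an interval falls apart at an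
  inner point. Of three points of a disc inside the arc, one has its parameter between those of the
  other two, which is a contradiction.\<close>

lemma interior_path_image_arc:
  fixes c :: "real \<Rightarrow> complex"
  assumes "Path_Connected.arc c"
  shows "interior (path_image c) = {}"
proof (rule ccontr)
  assume "interior (path_image c) \<noteq> {}"
  then obtain z where "z \<in> interior (path_image c)"
    by blast
  then obtain r where r: "r > 0" "ball z r \<subseteq> path_image c"
    by (meson mem_interior)
  obtain f g where fg: "homeomorphism (path_image c) {0..1::real} f g"
    using homeomorphic_arc_image_interval[OF assms, of 0 1] unfolding homeomorphic_def by auto
  have f: "continuous_on (path_image c) f" "inj_on f (path_image c)"
    using fg by (auto simp: homeomorphism_def intro: inj_on_inverseI)
  have between: False if p: "p \<in> ball z r" "x \<in> ball z r" "y \<in> ball z r" "f x < f p" "f p < f y" for p x y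
  proof -
    have "connected (ball z r - {p})"
      by (intro connected_open_delete) auto
    moreover have "continuous_on (ball z r - {p}) f"
      by (rule continuous_on_subset[OF f(1)]) (use r(2) in blast)
    ultimately have "connected (f ` (ball z r - {p}))"
      using connected_continuous_image by blast
    moreover have "f x \<in> f ` (ball z r - {p})" "f y \<in> f ` (ball z r - {p})"
      using p by auto
    ultimately have "{f x..f y} \<subseteq> f ` (ball z r - {p})"
      by (rule connected_contains_Icc)
    then have "f p \<in> f ` (ball z r - {p})"
      using p(4,5) by (auto simp only: atLeastAtMost_iff subset_iff less_imp_le)
    then obtain w where "w \<in> ball z r" "w \<noteq> p" "f p = f w"
      by blast
    then show False
      using inj_onD[OF f(2), of p w] p(1) r(2) by blast
  qed
  define x y where "x = z + complex_of_real (r/2)" and "y = z - complex_of_real (r/2)"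
  have mem: "x \<in> ball z r" "y \<in> ball z r" "z \<in> ball z r" and ne: "x \<noteq> y" "x \<noteq> z" "y \<noteq> z"
    using r(1) by (auto simp: x_def y_def dist_norm complex_eq_iff)
  have "f x \<noteq> f y" "f x \<noteq> f z" "f y \<noteq> f z"
    using f(2) mem ne r(2) by (meson inj_onD subsetD)+
  then show False
    using between mem by (meson linorder_neqE_linordered_idom)
qed

section \<open>Drawings of induced subgraphs\<close>

context plane_drawing
begin

definition subdrawing :: "'a set \<Rightarrow> complex set" where
  "subdrawing A = drawing_image (G \<restriction> A) pos crv"

lemma subdrawing_eq:
  "subdrawing A = pos ` A \<union> (\<Union>e\<in>{e\<in>arcs G. arc_vs G e \<subseteq> A}. path_image (crv e))"
  by (auto simp: subdrawing_def drawing_image_def arc_vs_def)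

lemma pos_in_crv: "e \<in> arcs G \<Longrightarrow> v \<in> arc_vs G e \<Longrightarrow> pos v \<in> path_image (crv e)"
  using pathstart_in_path_image[of "crv e"] pathfinish_in_path_image[of "crv e"]
  by (auto simp: arc_vs_def pathstart_crv pathfinish_crv)

lemma arc_vs_in_verts: "e \<in> arcs G \<Longrightarrow> arc_vs G e \<subseteq> verts G"
  by (simp add: arc_vs_def)

lemma compact_crv: "e \<in> arcs G \<Longrightarrow> compact (path_image (crv e))"
  using arc_crv compact_arc_image by blast

lemma compact_subdrawing:
  assumes "A \<subseteq> verts G"
  shows "compact (subdrawing A)"
proof -
  have "finite A"
    using assms finite_verts finite_subset by blast
  then have "compact (pos ` A)"
    by (simp add: finite_imp_compact)
  then show ?thesis
    unfolding subdrawing_eq using compact_crv by (intro compact_Un compact_UN) auto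
qed

lemma subdrawing_mono: "A \<subseteq> B \<Longrightarrow> subdrawing A \<subseteq> subdrawing B"
  unfolding subdrawing_eq by blast

lemma subdrawing_verts: "subdrawing (verts G) = drawing_image G pos crv"
  unfolding subdrawing_eq drawing_image_def using arc_vs_in_verts by auto

lemma subdrawing_disjoint:
  assumes A: "A \<subseteq> verts G" and B: "B \<subseteq> verts G" and AB: "A \<inter> B = {}"
  shows "subdrawing A \<inter> subdrawing B = {}"
proof -
  have vv: "pos v \<noteq> pos v'" if "v \<in> A" "v' \<in> B" for v v'
    using inj_pos that A B AB by (metis disjoint_iff inj_onD subsetD)
  have ve: "pos v \<notin> path_image (crv e)" if "v \<in> verts G" "e \<in> arcs G" "v \<notin> arc_vs G e" for v e
    using vertex_on_crv that by blast
  have ee: "path_image (crv e) \<inter> path_image (crv e') = {}"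
    if e: "e \<in> arcs G" "e' \<in> arcs G" and sub: "arc_vs G e \<subseteq> A" "arc_vs G e' \<subseteq> B" for e e'
  proof -
    have "arc_vs G e \<noteq> {}"
      by (simp add: arc_vs_def)
    then have "arc_vs G e \<noteq> arc_vs G e'" "arc_vs G e \<inter> arc_vs G e' = {}"
      using sub AB by blast+
    then show ?thesis
      using crv_no_crossing[OF e] by simp
  qed
  have "z \<notin> subdrawing B" if zA: "z \<in> subdrawing A" for z
  proof
    assume "z \<in> subdrawing B"
    then consider v where "v \<in> B" "z = pos v" |
        e where "e \<in> arcs G" "arc_vs G e \<subseteq> B" "z \<in> path_image (crv e)"
      unfolding subdrawing_eq by blast
    moreover consider v where "v \<in> A" "z = pos v" |
        e where "e \<in> arcs G" "arc_vs G e \<subseteq> A" "z \<in> path_image (crv e)"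
      using zA unfolding subdrawing_eq by blast
    ultimately show False
      using vv ve ee A B AB by (smt (verit) disjoint_iff subset_iff)
  qed
  then show ?thesis by blast
qed

definition adjacency :: "'a set \<Rightarrow> ('a \<times> 'a) set" where
  "adjacency A = {(a, b). a \<in> A \<and> b \<in> A \<and> (\<exists>e\<in>arcs G. arc_vs G e = {a, b})}"

lemma connected_subdrawing:
  assumes "\<And>x y. x \<in> A \<Longrightarrow> y \<in> A \<Longrightarrow> (x, y) \<in> (adjacency A)\<^sup>*"
  shows "connected (subdrawing A)"
proof (cases "A = {}")
  case True
  then show ?thesis
    by (simp add: subdrawing_eq arc_vs_def)
next
  case False
  then obtain x where x: "x \<in> A" by blast
  have edge: "connected_component (subdrawing A) z z'"
    if "e \<in> arcs G" "arc_vs G e \<subseteq> A" "z \<in> path_image (crv e)" "z' \<in> path_image (crv e)" for e z z'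
    unfolding connected_component_def
    using that arc_crv by (intro exI[of _ "path_image (crv e)"]) (auto simp: subdrawing_eq connected_arc_image)
  have vertex: "connected_component (subdrawing A) (pos x) (pos y)" if "y \<in> A" for y
    using assms[OF x that]
  proof (induction rule: rtrancl_induct)
    case base
    then show ?case
      using x by (simp add: subdrawing_eq)
  next
    case (step y z)
    then obtain e where "e \<in> arcs G" "arc_vs G e = {y, z}" "y \<in> A" "z \<in> A"
      by (auto simp: adjacency_def)
    then have "connected_component (subdrawing A) (pos y) (pos z)"
      using edge[of e "pos y" "pos z"] pos_in_crv[of e y] pos_in_crv[of e z] by simp
    then show ?case
      using step connected_component_trans by blast
  qed
  have all: "connected_component (subdrawing A) (pos x) z" if z: "z \<in> subdrawing A" for z
  proof -
    consider v where "v \<in> A" "z = pos v" |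
        e where "e \<in> arcs G" "arc_vs G e \<subseteq> A" "z \<in> path_image (crv e)"
      using z unfolding subdrawing_eq by blast
    then show ?thesis
    proof cases
      case 1
      then show ?thesis using vertex by simp
    next
      case 2
      have "tail G e \<in> arc_vs G e"
        by (simp add: arc_vs_def)
      then have "connected_component (subdrawing A) (pos (tail G e)) z" "tail G e \<in> A"
        using edge[OF 2(1,2) pos_in_crv 2(3)] 2 by blast+
      then show ?thesis
        using vertex connected_component_trans by metis
    qed
  qed
  then show ?thesis
    unfolding connected_iff_connected_component
    by (meson connected_component_sym connected_component_trans)
qed

text \<open>As \<open>G\<close> is symmetric, this is the vertex set of a connected
  component.\<close>

definition reach :: "'a \<Rightarrow> 'a set" where
  "reach r = {v. r \<rightarrow>\<^sup>*\<^bsub>G\<^esub> v}"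

lemma reach_subset: "reach r \<subseteq> verts G"
  using reachable_in_verts(2) by (auto simp: reach_def)

lemma root_in_reach: "r \<in> verts G \<Longrightarrow> r \<in> reach r"
  by (simp add: reach_def)

lemma reach_eq: "s \<in> reach r \<Longrightarrow> reach s = reach r"
  unfolding reach_def using reachable_trans symmetric_reachable' by blast

lemma reach_disjoint: "reach r \<noteq> reach s \<Longrightarrow> reach r \<inter> reach s = {}"
  using reach_eq by blast

lemma arc_vs_reach:
  assumes "e \<in> arcs G" "arc_vs G e \<inter> reach r \<noteq> {}"
  shows "arc_vs G e \<subseteq> reach r"
proof -
  have "tail G e \<rightarrow>\<^bsub>G\<^esub> head G e"
    using assms(1) by (auto simp: arcs_ends_def arc_to_ends_def)
  then have "tail G e \<rightarrow>\<^sup>*\<^bsub>G\<^esub> head G e" "head G e \<rightarrow>\<^sup>*\<^bsub>G\<^esub> tail G e"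
    using symmetric_reachable' by blast+
  then show ?thesis
    using assms(2) reachable_trans unfolding reach_def arc_vs_def by blast
qed

lemma adjacency_sym: "sym (adjacency A)"
  by (auto simp: sym_def adjacency_def insert_commute)

lemma connected_subdrawing_reach: "connected (subdrawing (reach r))"
proof (rule connected_subdrawing)
  have root: "(r, y) \<in> (adjacency (reach r))\<^sup>*" if "y \<in> reach r" for y
  proof -
    have "r \<rightarrow>\<^sup>*\<^bsub>G\<^esub> y"
      using that by (simp add: reach_def)
    then show ?thesis
    proof (induction rule: reachable_induct)
      case (step y z)
      then have "y \<in> reach r" "z \<in> reach r"
        using reachable_adj_trans by (auto simp: reach_def)
      moreover obtain e where "e \<in> arcs G" "arc_vs G e = {y, z}"
        using step(2) by (auto simp: arc_vs_def)
      ultimately have "(y, z) \<in> adjacency (reach r)"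
        by (auto simp: adjacency_def)
      then show ?case
        using step(3) by simp
    qed simp
  qed
  show "(x, y) \<in> (adjacency (reach r))\<^sup>*" if "x \<in> reach r" "y \<in> reach r" for x y
    using root[OF that(1)] root[OF that(2)] sym_rtrancl[OF adjacency_sym]
    by (meson rtrancl_trans symD)
qed

lemma drawing_image_Union: "drawing_image G pos crv = \<Union>(subdrawing ` reach ` verts G)"
proof
  show "\<Union>(subdrawing ` reach ` verts G) \<subseteq> drawing_image G pos crv"
    using subdrawing_mono[OF reach_subset] subdrawing_verts by blast
  show "drawing_image G pos crv \<subseteq> \<Union>(subdrawing ` reach ` verts G)"
  proof
    fix z assume "z \<in> drawing_image G pos crv"
    then consider v where "v \<in> verts G" "z = pos v" |
        e where "e \<in> arcs G" "z \<in> path_image (crv e)"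
      by (auto simp: drawing_image_def)
    then show "z \<in> \<Union>(subdrawing ` reach ` verts G)"
    proof cases
      case 1
      then have "z \<in> subdrawing (reach v)"
        using root_in_reach by (auto simp: subdrawing_eq)
      then show ?thesis using 1 by blast
    next
      case 2
      have "tail G e \<in> reach (tail G e)"
        using 2 root_in_reach by simp
      then have "arc_vs G e \<subseteq> reach (tail G e)"
        using arc_vs_reach[OF 2(1), of "tail G e"] unfolding arc_vs_def by blast
      then have "z \<in> subdrawing (reach (tail G e))"
        using 2 by (auto simp: subdrawing_eq)
      then show ?thesis
        using 2 by auto
    qed
  qed
qed

section \<open>A drawn shortest-path tree\<close>

definition walk_image :: "'a \<Rightarrow> 'b awalk \<Rightarrow> complex set" where
  "walk_image u p = pos ` set (awalk_verts u p) \<union> (\<Union>e\<in>set p. path_image (crv e))"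

lemma walk_image_properties:
  assumes "awalk u p v"
  shows "compact (walk_image u p) \<and> path_connected (walk_image u p) \<and> pos u \<in> walk_image u p \<and>
    pos v \<in> walk_image u p \<and> (\<forall>e\<in>set p. e \<in> arcs G \<and> arc_vs G e \<subseteq> set (awalk_verts u p)) \<and>
    set (awalk_verts u p) \<subseteq> verts G"
  using assms
proof (induction p arbitrary: u)
  case Nil
  then show ?case
    by (auto simp: walk_image_def awalk_Nil_iff)
next
  case (Cons e p)
  then have e: "e \<in> arcs G" "u = tail G e" "awalk (head G e) p v"
    by (auto simp: awalk_Cons_iff)
  note IH = Cons.IH[OF e(3)]
  have ends: "pos (tail G e) \<in> path_image (crv e)" "pos (head G e) \<in> path_image (crv e)"
    using pos_in_crv[OF e(1)] by (simp_all add: arc_vs_def)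
  then have im: "walk_image u (e # p) = path_image (crv e) \<union> walk_image (head G e) p"
    by (auto simp: walk_image_def)
  have head: "head G e \<in> set (awalk_verts (head G e) p)"
    using e(3) by (rule hd_in_awalk_verts)
  have "path_connected (path_image (crv e))"
    using arc_crv[OF e(1)] arc_imp_path path_connected_path_image by blast
  then have "path_connected (walk_image u (e # p))"
    unfolding im using IH ends by (intro path_connected_Un) auto
  moreover have "compact (walk_image u (e # p))"
    unfolding im using IH compact_crv[OF e(1)] by (intro compact_Un) auto
  moreover have "tail G e \<in> verts G"
    using e(1) by simp
  ultimately show ?case
    using IH ends head e im by (auto simp: arc_vs_def)
qed

lemma walk_image_subset_subdrawing:
  assumes "awalk u p v" "set (awalk_verts u p) \<subseteq> A"
  shows "walk_image u p \<subseteq> subdrawing A"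
  using walk_image_properties[OF assms(1)] assms(2) unfolding walk_image_def subdrawing_eq by blast

lemma walk_image_snoc:
  assumes "awalk u p (tail G e)" "e \<in> arcs G"
  shows "awalk u (p @ [e]) (head G e)" "awalk_verts u (p @ [e]) = awalk_verts u p @ [head G e]"
    "walk_image u (p @ [e]) = walk_image u p \<union> path_image (crv e)"
proof -
  have "awalk (tail G e) [e] (head G e)"
    using assms(2) by (simp add: awalk_simps)
  then show w: "awalk u (p @ [e]) (head G e)"
    using assms(1) by (rule awalk_appendI[rotated])
  show v: "awalk_verts u (p @ [e]) = awalk_verts u p @ [head G e]"
    using awalk_verts_append[OF w] by simp
  have "pos (head G e) \<in> path_image (crv e)"
    using pos_in_crv[OF assms(2)] by (simp add: arc_vs_def)
  then show "walk_image u (p @ [e]) = walk_image u p \<union> path_image (crv e)"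
    unfolding walk_image_def v by auto
qed

lemma awalk_leaves_set:
  assumes "awalk u q v" "u \<in> S" "v \<notin> S"
  shows "\<exists>q1 e q2. q = q1 @ e # q2 \<and> tail G e \<in> S \<and> head G e \<notin> S"
  using assms
proof (induction q arbitrary: u)
  case Nil
  then show ?case by (simp add: awalk_Nil_iff)
next
  case (Cons e q)
  then have e: "u = tail G e" "awalk (head G e) q v"
    by (auto simp: awalk_Cons_iff)
  show ?case
  proof (cases "head G e \<in> S")
    case True
    then obtain q1 e' q2 where "q = q1 @ e' # q2" "tail G e' \<in> S" "head G e' \<notin> S"
      using Cons.IH[OF e(2)] Cons.prems(3) by blast
    then show ?thesis
      by (intro exI[of _ "e # q1"]) auto
  next
    case False
    then show ?thesis
      using e(1) Cons.prems(2) by (intro exI[of _ "[]"]) auto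
  qed
qed

text \<open>That the paths form a tree enters only through the connected complement of their drawn
  union, which is what the arguments about chords use. The set \<open>S\<close> is the part of the
  component spanned so far.\<close>

definition shortest_path_tree :: "'b weight_fun \<Rightarrow> 'a \<Rightarrow> 'a set \<Rightarrow> ('a \<Rightarrow> 'b awalk) \<Rightarrow> bool" where
  "shortest_path_tree w r S p \<longleftrightarrow> r \<in> S \<and> S \<subseteq> reach r \<and>
     (\<forall>v\<in>S. shortest_path G w r (p v) v \<and> set (awalk_verts r (p v)) \<subseteq> S) \<and>
     connected (- (\<Union>v\<in>S. walk_image r (p v)))"

text \<open>An exchange argument: on a shortest path to \<open>v\<close> the part up to
  \<open>head G e\<close> is itself cheapest, and its part before \<open>e\<close> can be replaced
  by \<open>p\<close>. Weights may be zero, so minimal cost alone does not exclude a repeated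
  vertex; the second condition on \<open>p\<close> does.\<close>

lemma shortest_path_snoc:
  assumes w: "edge_weight G w" and q: "apath r (q1 @ e # q2) v" "\<mu> w r v = ereal (awalk_cost w (q1 @ e # q2))"
    and p: "shortest_path G w r p (tail G e)" "head G e \<notin> set (awalk_verts r p)"
  shows "shortest_path G w r (p @ [e]) (head G e)"
proof -
  have nonneg: "\<And>e. e \<in> arcs G \<Longrightarrow> 0 \<le> w e"
    using w unfolding edge_weight_def by blast
  have "awalk r (q1 @ e # q2) v"
    using q(1) by (simp add: apath_def)
  then have q': "awalk r q1 (tail G e)" "e \<in> arcs G" "awalk (head G e) q2 v"
    by (auto simp: awalk_Cons_iff)
  have p': "awalk r p (tail G e)" "distinct (awalk_verts r p)" "ereal (awalk_cost w p) = \<mu> w r (tail G e)"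
    using p by (auto simp: shortest_path_def apath_def)
  note snoc = walk_image_snoc[OF p'(1) q'(2)]
  have "r \<rightarrow>\<^sup>*\<^bsub>G\<^esub> head G e"
    using snoc(1) reachable_awalk by blast
  then obtain q3 where q3: "apath r q3 (head G e)" "\<mu> w r (head G e) = ereal (awalk_cost w q3)"
    using min_cost_awalk nonneg by blast
  have "awalk r (q3 @ q2) v"
    using q3(1) q'(3) by (auto simp: apath_def intro: awalk_appendI)
  then have "\<mu> w r v \<le> ereal (awalk_cost w (q3 @ q2))"
    by (rule min_cost_le_walk_cost)
  then have 1: "awalk_cost w q1 + w e \<le> awalk_cost w q3"
    unfolding q(2) by simp
  have "\<mu> w r (tail G e) \<le> ereal (awalk_cost w q1)"
    using q'(1) by (rule min_cost_le_walk_cost)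
  then have 2: "awalk_cost w p \<le> awalk_cost w q1"
    using p'(3) by (metis ereal_less_eq(3))
  have "\<mu> w r (head G e) \<le> ereal (awalk_cost w (p @ [e]))"
    using snoc(1) by (rule min_cost_le_walk_cost)
  then have "\<mu> w r (head G e) = ereal (awalk_cost w (p @ [e]))"
    using 1 2 unfolding q3(2) by simp
  moreover have "apath r (p @ [e]) (head G e)"
    using snoc(1,2) p'(2) p(2) by (simp add: apath_def)
  ultimately show ?thesis
    by (simp add: shortest_path_def)
qed

lemma shortest_path_tree_grow:
  assumes w: "edge_weight G w" and S: "shortest_path_tree w r S p" "S \<noteq> reach r"
  shows "\<exists>x p'. x \<notin> S \<and> shortest_path_tree w r (insert x S) p'"
proof -
  have sp: "r \<in> S" "S \<subseteq> reach r" "\<And>v. v \<in> S \<Longrightarrow> shortest_path G w r (p v) v"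
    "\<And>v. v \<in> S \<Longrightarrow> set (awalk_verts r (p v)) \<subseteq> S"
    and con: "connected (- (\<Union>v\<in>S. walk_image r (p v)))"
    using S(1) by (auto simp: shortest_path_tree_def)
  have walk: "awalk r (p v) v" if "v \<in> S" for v
    using sp(3)[OF that] by (simp add: shortest_path_def apath_def)
  obtain y where y: "y \<in> reach r" "y \<notin> S"
    using S(2) sp(2) by blast
  have nonneg: "\<And>e. e \<in> arcs G \<Longrightarrow> 0 \<le> w e"
    using w unfolding edge_weight_def by blast
  obtain q where q: "apath r q y" "\<mu> w r y = ereal (awalk_cost w q)"
    using min_cost_awalk[of r y w] y(1) nonneg by (auto simp: reach_def)
  then have qw: "awalk r q y"
    by (simp add: apath_def)
  \<comment> \<open>A shortest path to a vertex outside \<open>S\<close> must leave \<open>S\<close>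
    by some edge; the tree grows by that edge.\<close>
  obtain q1 e q2 where e: "q = q1 @ e # q2" "tail G e \<in> S" "head G e \<notin> S"
    using awalk_leaves_set[OF qw sp(1) y(2)] by blast
  define t x where "t = tail G e" and "x = head G e"
  have eG: "e \<in> arcs G"
    using qw e(1) by auto
  have tx: "t \<in> S" "x \<notin> S" "arc_vs G e = {t, x}"
    using e by (auto simp: t_def x_def arc_vs_def)
  have short: "shortest_path G w r (p t @ [e]) x"
    unfolding x_def using shortest_path_snoc[OF w q[unfolded e(1)]] sp(3,4) tx(1,2) by (auto simp: t_def x_def)
  note snoc = walk_image_snoc[OF walk[OF e(2)] eG]
  define T where "T = (\<Union>v\<in>S. walk_image r (p v))"
  have finS: "finite S"
    using sp(2) reach_subset finite_verts by (meson finite_subset)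
  have "compact T"
    unfolding T_def using finS walk_image_properties[OF walk] by (intro compact_UN) auto
  have "T \<subseteq> subdrawing S"
    unfolding T_def using walk_image_subset_subdrawing[OF walk sp(4)] by blast
  moreover have "path_image (crv e) \<inter> subdrawing S \<subseteq> {pos t}"
  proof
    fix z assume z: "z \<in> path_image (crv e) \<inter> subdrawing S"
    then consider v where "v \<in> S" "z = pos v" |
        e' where "e' \<in> arcs G" "arc_vs G e' \<subseteq> S" "z \<in> path_image (crv e')"
      unfolding subdrawing_eq by blast
    then show "z \<in> {pos t}"
    proof cases
      case 1
      then have "v \<in> arc_vs G e"
        using vertex_on_crv[OF eG, of v] z sp(2) reach_subset by blast
      then show ?thesis
        using 1 tx by auto
    next
      case 2
      then have "arc_vs G e \<noteq> arc_vs G e'" "arc_vs G e \<inter> arc_vs G e' \<subseteq> {t}"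
        using tx by auto
      then show ?thesis
        using crv_no_crossing[OF eG 2(1)] z 2(3) by blast
    qed
  qed
  moreover have "pos t \<in> path_image (crv e)" "pos t \<in> T"
    using pos_in_crv[OF eG] tx walk_image_properties[OF walk[OF tx(1)]] unfolding T_def by auto
  ultimately have "T \<inter> path_image (crv e) = {pos t}"
    by blast
  \<comment> \<open>A tree and an arc that share a single point do not enclose a region, by
    Janiszewski's theorem.\<close>
  then have "connected (T \<inter> path_image (crv e))"
    by simp
  then have "connected (- (T \<union> path_image (crv e)))"
    using Janiszewski_connected[OF \<open>compact T\<close> closed_arc_image[OF arc_crv[OF eG]]]
      con connected_arc_complement[OF arc_crv[OF eG]] unfolding T_def by simp
  moreover define p' where "p' = p(x := p t @ [e])"
  have p': "p' v = p v" if "v \<in> S" for v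
    using that tx(2) by (auto simp: p'_def)
  have "(\<Union>v\<in>insert x S. walk_image r (p' v)) = walk_image r (p' x) \<union> T"
    using p' by (auto simp: T_def)
  moreover have "walk_image r (p' x) \<union> T = T \<union> path_image (crv e)"
    using snoc(3) tx(1) by (auto simp: p'_def T_def t_def)
  ultimately have "connected (- (\<Union>v\<in>insert x S. walk_image r (p' v)))"
    by simp
  moreover have "x \<in> reach r"
    using arc_vs_reach[OF eG, of r] tx sp(2) by blast
  moreover have "shortest_path G w r (p' v) v \<and> set (awalk_verts r (p' v)) \<subseteq> insert x S"
    if "v \<in> insert x S" for v
  proof (cases "v = x")
    case True
    then show ?thesis
      using short snoc(2) sp(4)[OF tx(1)] by (auto simp: p'_def t_def x_def)
  next
    case False
    then show ?thesis
      using that p' sp(3,4) by auto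
  qed
  ultimately have "shortest_path_tree w r (insert x S) p'"
    unfolding shortest_path_tree_def using sp(1,2) by blast
  then show ?thesis
    using tx(2) by blast
qed

lemma shortest_path_tree_exists:
  assumes w: "edge_weight G w" and r: "r \<in> verts G"
  shows "\<exists>p. shortest_path_tree w r (reach r) p"
proof -
  have extend: "\<exists>p'. shortest_path_tree w r (reach r) p'"
    if "shortest_path_tree w r S p" for S p
    using that
  proof (induction "card (reach r - S)" arbitrary: S p rule: less_induct)
    case less
    show ?case
    proof (cases "S = reach r")
      case False
      then obtain x p' where x: "x \<notin> S" "shortest_path_tree w r (insert x S) p'"
        using shortest_path_tree_grow[OF w less.prems] by blast
      then have "x \<in> reach r"
        by (simp add: shortest_path_tree_def)
      moreover have "finite (reach r)"
        using reach_subset finite_verts by (rule finite_subset)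
      ultimately have "card (reach r - insert x S) < card (reach r - S)"
        using x(1) by (intro psubset_card_mono) auto
      then show ?thesis
        using less.hyps x(2) by blast
    qed (use less.prems in auto)
  qed
  have "awalk r [] r"
    using r by (simp add: awalk_Nil_iff)
  then have "\<mu> w r r \<le> ereal (awalk_cost w [])"
    by (rule min_cost_le_walk_cost)
  moreover have "\<mu> w r r \<ge> 0"
    unfolding \<mu>_def
  proof (rule INF_greatest)
    have nonneg: "\<And>e. e \<in> arcs G \<Longrightarrow> 0 \<le> w e"
      using w unfolding edge_weight_def by blast
    fix q assume "q \<in> {q. awalk r q r}"
    then show "0 \<le> ereal (awalk_cost w q)"
      using pos_cost_pos_awalk_cost[of r q r w] nonneg by simp
  qed
  ultimately have "shortest_path G w r [] r"
    using r by (simp add: shortest_path_def apath_Nil_iff zero_ereal_def)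
  then have "shortest_path_tree w r {r} (\<lambda>_. [])"
    using root_in_reach[OF r]
    by (simp add: shortest_path_tree_def walk_image_def connected_punctured_universe flip: Compl_eq_Diff_UNIV)
  then show ?thesis
    by (rule extend)
qed

lemma tree_drawing_exists:
  assumes w: "edge_weight G w" and r: "r \<in> verts G"
  obtains T p E where "\<And>v. v \<in> reach r \<Longrightarrow> shortest_path G w r (p v) v"
    "tree_drawing T (pos ` reach r) (\<lambda>z. walk_image r (p (inv_into (reach r) pos z))) E crv"
    "E \<subseteq> arcs G" "tree_drawing.drawing T E crv = subdrawing (reach r)"
    "pos ` reach r \<subseteq> T"
proof -
  define A where "A = reach r"
  obtain p where p: "shortest_path_tree w r A p"
    using shortest_path_tree_exists[OF w r] unfolding A_def by blast
  then have sp: "r \<in> A" "\<And>v. v \<in> A \<Longrightarrow> shortest_path G w r (p v) v"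
    "\<And>v. v \<in> A \<Longrightarrow> set (awalk_verts r (p v)) \<subseteq> A"
    and con: "connected (- (\<Union>v\<in>A. walk_image r (p v)))"
    by (auto simp: shortest_path_tree_def)
  have walk: "awalk r (p v) v" if "v \<in> A" for v
    using sp(2)[OF that] by (simp add: shortest_path_def apath_def)
  note wi = walk_image_properties[OF walk]
  define T where "T = (\<Union>v\<in>A. walk_image r (p v))"
  \<comment> \<open>Excluding curves inside \<open>T\<close>, rather than the arcs of the paths,
    also drops the opposite arcs of tree arcs.\<close>
  define E where "E = {e \<in> arcs G. arc_vs G e \<subseteq> A \<and> \<not> path_image (crv e) \<subseteq> T}"
  \<comment> \<open>The vertices of a \<open>tree_drawing\<close> are points of the plane, hence the
    inverse of \<open>pos\<close>.\<close>
  define P where "P z = walk_image r (p (inv_into A pos z))" for z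
  have finA: "finite A" and AG: "A \<subseteq> verts G"
    unfolding A_def using reach_subset finite_verts finite_subset by blast+
  have inv: "inv_into A pos (pos v) = v" if "v \<in> A" for v
    using that inv_into_f_f[OF inj_on_subset[OF inj_pos AG]] by blast
  have posA: "pos ` A \<subseteq> T"
    using wi unfolding T_def by blast
  have T_cases: "(\<exists>v\<in>A. z = pos v) \<or> (\<exists>e\<in>arcs G. arc_vs G e \<subseteq> A \<and> path_image (crv e) \<subseteq> T \<and> z \<in> path_image (crv e))"
    if "z \<in> T" for z
  proof -
    obtain v where v: "v \<in> A" "z \<in> walk_image r (p v)"
      using \<open>z \<in> T\<close> unfolding T_def by blast
    then consider x where "x \<in> set (awalk_verts r (p v))" "z = pos x" |
        e where "e \<in> set (p v)" "z \<in> path_image (crv e)"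
      unfolding walk_image_def by blast
    then show ?thesis
    proof cases
      case 1
      then show ?thesis using sp(3)[OF v(1)] by blast
    next
      case 2
      then have "path_image (crv e) \<subseteq> T"
        using v unfolding T_def walk_image_def by blast
      moreover have "e \<in> arcs G" "arc_vs G e \<subseteq> A"
        using wi[OF v(1)] sp(3)[OF v(1)] 2(1) by blast+
      ultimately show ?thesis
        using 2(2) by blast
    qed
  qed
  have meets: "path_image (crv e) \<inter> path_image (crv e') \<subseteq> pos ` arc_vs G e"
    if "e \<in> arcs G" "e' \<in> arcs G" "path_image (crv e) \<noteq> path_image (crv e')" for e e'
    using crv_no_crossing[OF that(1,2)] crv_same_edge[OF that(1,2)] that(3) by blast
  have crT: "path_image (crv e) \<inter> T = pos ` arc_vs G e" if e: "e \<in> E" for e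
  proof
    have eG: "e \<in> arcs G" "arc_vs G e \<subseteq> A" "\<not> path_image (crv e) \<subseteq> T"
      using e by (auto simp: E_def)
    show "pos ` arc_vs G e \<subseteq> path_image (crv e) \<inter> T"
      using pos_in_crv[OF eG(1)] eG(2) posA by blast
    show "path_image (crv e) \<inter> T \<subseteq> pos ` arc_vs G e"
    proof
      fix z assume z: "z \<in> path_image (crv e) \<inter> T"
      then consider v where "v \<in> A" "z = pos v" |
          e' where "e' \<in> arcs G" "path_image (crv e') \<subseteq> T" "z \<in> path_image (crv e')"
        using T_cases by blast
      then show "z \<in> pos ` arc_vs G e"
      proof cases
        case 1
        then show ?thesis
          using vertex_on_crv[OF eG(1), of v] z AG by blast
      next
        case 2
        then show ?thesis
          using meets[OF eG(1) 2(1)] eG(3) z by blast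
      qed
    qed
  qed
  have ends: "pos ` arc_vs G e = {pathstart (crv e), pathfinish (crv e)}" if "e \<in> arcs G" for e
    using that by (simp add: arc_vs_def pathstart_crv pathfinish_crv)
  have "compact T"
    unfolding T_def using finA wi by (intro compact_UN) auto
  have root: "pos r \<in> walk_image r (p v)" if "v \<in> A" for v
    using wi[OF that] by blast
  have "path_connected T"
  proof -
    have "path_component T (pos r) z" if zT: "z \<in> T" for z
    proof -
      obtain v where v: "v \<in> A" "z \<in> walk_image r (p v)"
        using zT unfolding T_def by blast
      then have "path_component (walk_image r (p v)) (pos r) z"
        using wi[OF v(1)] by (simp add: path_connected_component)
      then show ?thesis
        by (rule path_component_of_subset[rotated]) (use v T_def in blast)
    qed
    then show ?thesis
      unfolding path_connected_component by (meson path_component_sym path_component_trans)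
  qed
  have tree: "tree_drawing T (pos ` A) P E crv"
  proof unfold_locales
    show "compact T" "path_connected T" "connected (- T)"
      using \<open>compact T\<close> \<open>path_connected T\<close> con by (auto simp: T_def)
    show "pos ` A \<noteq> {}"
      using sp(1) by blast
    show "finite E"
      using finite_subset[of E "arcs G"] by (auto simp: E_def)
    fix z assume z: "z \<in> pos ` A"
    then obtain v where v: "v \<in> A" "z = pos v" by blast
    show "compact (P z)" "z \<in> P z"
      using wi[OF v(1)] inv v by (auto simp: P_def)
    show "P z \<subseteq> T"
      using inv v by (auto simp: P_def T_def)
    fix z' assume "z' \<in> pos ` A"
    then obtain v' where v': "v' \<in> A" "z' = pos v'" by blast
    have "connected (walk_image r (p v) \<union> walk_image r (p v'))"
      using wi[OF v(1)] wi[OF v'(1)] root[OF v(1)] root[OF v'(1)]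
      by (intro connected_Un) (auto intro: path_connected_imp_connected)
    then show "connected (P z \<union> P z')"
      using inv v v' by (simp add: P_def)
  next
    fix e assume e: "e \<in> E"
    then have eG: "e \<in> arcs G" "arc_vs G e \<subseteq> A"
      by (auto simp: E_def)
    show "Path_Connected.arc (crv e)"
      using arc_crv eG by blast
    show "pathstart (crv e) \<in> pos ` A" "pathfinish (crv e) \<in> pos ` A"
      using ends[OF eG(1)] eG(2) by blast+
    show "path_image (crv e) \<inter> T = {pathstart (crv e), pathfinish (crv e)}"
      using crT[OF e] ends[OF eG(1)] by simp
    fix e' assume "e' \<in> E"
    then have "e' \<in> arcs G" by (simp add: E_def)
    then show "path_image (crv e) = path_image (crv e') \<or> path_image (crv e) \<inter> path_image (crv e') \<subseteq> T"
      using meets[OF eG(1)] eG(2) posA by blast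
  qed
  have "tree_drawing.drawing T E crv = T \<union> (\<Union>e\<in>E. path_image (crv e))"
    by (rule tree_drawing.drawing_def[OF tree])
  also have "\<dots> = subdrawing A"
  proof
    have "T \<subseteq> subdrawing A"
      unfolding T_def using walk_image_subset_subdrawing[OF walk sp(3)] by blast
    then show "T \<union> (\<Union>e\<in>E. path_image (crv e)) \<subseteq> subdrawing A"
      unfolding subdrawing_eq E_def by blast
    show "subdrawing A \<subseteq> T \<union> (\<Union>e\<in>E. path_image (crv e))"
      unfolding subdrawing_eq using posA by (auto simp: E_def)
  qed
  finally show ?thesis
    using that[of p T E] sp(2) tree posA unfolding A_def P_def E_def by auto
qed

lemma finite_components_reach:
  assumes "r \<in> verts G"
  shows "finite (components (- subdrawing (reach r)))"
proof -
  \<comment> \<open>Any spanning tree will do here, so all weights are set to zero.\<close>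
  have "edge_weight G (\<lambda>_. 0)"
    by (simp add: edge_weight_def)
  then obtain T p E where "tree_drawing T (pos ` reach r) (\<lambda>z. walk_image r (p (inv_into (reach r) pos z))) E crv"
    "tree_drawing.drawing T E crv = subdrawing (reach r)"
    using tree_drawing_exists[OF _ assms] by metis
  then show ?thesis
    using tree_drawing.finite_components_drawing by metis
qed

text \<open>Transfers \<open>balanced_separator\<close> from the plane to the graph: a connected
  vertex set that avoids both paths is drawn as a \<open>separator\<close>, since the edges at the
  removed vertices are removed with them.\<close>

lemma component_separator:
  assumes w: "edge_weight G w" and r: "r \<in> verts G"
    and F: "finite F" "F \<subseteq> components (- subdrawing (reach r))"
  obtains u v P Q where "shortest_path G w r P u" "shortest_path G w r Q v"
    "\<forall>C. C \<subseteq> reach r - (set (awalk_verts r P) \<union> set (awalk_verts r Q)) \<longrightarrow> connected (subdrawing C) \<longrightarrow>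
      real (card {f \<in> F. closure f \<inter> subdrawing C \<noteq> {}}) \<le> 2 / 3 * real (card F) + 1"
proof -
  obtain T p E where sp: "\<And>v. v \<in> reach r \<Longrightarrow> shortest_path G w r (p v) v"
    and tree: "tree_drawing T (pos ` reach r) (\<lambda>z. walk_image r (p (inv_into (reach r) pos z))) E crv"
    and E: "E \<subseteq> arcs G" and drawing: "tree_drawing.drawing T E crv = subdrawing (reach r)"
    and posT: "pos ` reach r \<subseteq> T"
    using tree_drawing_exists[OF w r] by metis
  interpret tree_drawing T "pos ` reach r" "\<lambda>z. walk_image r (p (inv_into (reach r) pos z))" E crv
    by (rule tree)
  obtain u v where uv: "u \<in> reach r" "v \<in> reach r"
    and sep: "\<And>Q. separator (pos u) (pos v) Q \<Longrightarrow>
      real (card {f \<in> F. closure f \<inter> Q \<noteq> {}}) \<le> 2 / 3 * real (card F) + 1"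
    using balanced_separator[OF F(1)] F(2) unfolding drawing by blast
  have inv: "inv_into (reach r) pos (pos x) = x" if "x \<in> reach r" for x
    using that inv_into_f_f[OF inj_on_subset[OF inj_pos reach_subset]] by blast
  show ?thesis
  proof (rule that[OF sp[OF uv(1)] sp[OF uv(2)]], intro allI impI)
    fix C assume C: "C \<subseteq> reach r - (set (awalk_verts r (p u)) \<union> set (awalk_verts r (p v)))"
      and con: "connected (subdrawing C)"
    have CG: "C \<subseteq> verts G"
      using C reach_subset by blast
    have avoid: "subdrawing C \<inter> walk_image r (p x) = {}" and notin: "x \<notin> C" if x: "x \<in> {u, v}" for x
    proof -
      have walk: "awalk r (p x) x"
        using sp uv x by (auto simp: shortest_path_def apath_def)
      then have "set (awalk_verts r (p x)) \<subseteq> verts G"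
        using walk_image_properties by blast
      moreover have "C \<inter> set (awalk_verts r (p x)) = {}"
        using C x by blast
      ultimately have "subdrawing C \<inter> subdrawing (set (awalk_verts r (p x))) = {}"
        using subdrawing_disjoint[OF CG] by blast
      then show "subdrawing C \<inter> walk_image r (p x) = {}"
        using walk_image_subset_subdrawing[OF walk order_refl] by blast
      have "last (awalk_verts r (p x)) = x"
        using walk by simp
      then have "x \<in> set (awalk_verts r (p x))"
        using last_in_set by (metis awalk_verts_non_Nil)
      then show "x \<notin> C"
        using C x by blast
    qed
    \<comment> \<open>An edge at \<open>u\<close> or \<open>v\<close> is not an edge within
      \<open>C\<close>, so it can meet the drawing of \<open>C\<close> only in vertices, and all
      vertices lie on \<open>T\<close>.\<close>
    have "subdrawing C \<inter> (path_image (crv e) - T) = {}"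
      if e: "e \<in> E" and x: "x \<in> {u, v}" "pos x \<in> path_image (crv e)" for e x
    proof -
      have eG: "e \<in> arcs G"
        using e E by blast
      have "x \<in> arc_vs G e"
        using vertex_on_crv[OF eG _ x(2)] x(1) uv reach_subset by blast
      then have eC: "\<not> arc_vs G e \<subseteq> C" and er: "arc_vs G e \<subseteq> reach r"
        using notin[OF x(1)] arc_vs_reach[OF eG, of r] x(1) uv by blast+
      have "z \<in> T" if z: "z \<in> subdrawing C" "z \<in> path_image (crv e)" for z
      proof -
        consider y where "y \<in> C" "z = pos y" |
            e' where "e' \<in> arcs G" "arc_vs G e' \<subseteq> C" "z \<in> path_image (crv e')"
          using z(1) unfolding subdrawing_eq by blast
        then show ?thesis
        proof cases
          case 1
          then show ?thesis using C posT by blast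
        next
          case 2
          then have "arc_vs G e \<noteq> arc_vs G e'"
            using eC by blast
          then have "z \<in> pos ` (arc_vs G e \<inter> arc_vs G e')"
            using crv_no_crossing[OF eG 2(1)] 2(3) z(2) by blast
          then show ?thesis
            using er posT by blast
        qed
      qed
      then show ?thesis by blast
    qed
    moreover have "subdrawing C \<inter> (walk_image r (p u) \<union> walk_image r (p v)) = {}"
      using avoid[of u] avoid[of v] by blast
    moreover have "subdrawing C \<subseteq> subdrawing (reach r)"
      using C by (intro subdrawing_mono) blast
    ultimately have "separator (pos u) (pos v) (subdrawing C)"
      unfolding separator_def drawing inv[OF uv(1)] inv[OF uv(2)] using con by blast
    then show "real (card {f \<in> F. closure f \<inter> subdrawing C \<noteq> {}}) \<le> 2 / 3 * real (card F) + 1"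
      by (rule sep)
  qed
qed

section \<open>Faces of the whole drawing\<close>

lemma finite_reach_drawings:
  "finite (subdrawing ` reach ` verts G)" "disjoint (subdrawing ` reach ` verts G)"
  "D \<in> subdrawing ` reach ` verts G \<Longrightarrow> compact D \<and> connected D \<and> finite (components (- D))"
proof -
  show "finite (subdrawing ` reach ` verts G)"
    by simp
  show "disjoint (subdrawing ` reach ` verts G)"
  proof (intro pairwiseI)
    fix D D' assume "D \<in> subdrawing ` reach ` verts G" "D' \<in> subdrawing ` reach ` verts G" "D \<noteq> D'"
    moreover from this obtain r s where "D = subdrawing (reach r)" "D' = subdrawing (reach s)"
      by blast
    ultimately have "D = subdrawing (reach r)" "D' = subdrawing (reach s)" "reach r \<noteq> reach s"
      by auto
    then show "disjnt D D'"
      using subdrawing_disjoint[OF reach_subset reach_subset reach_disjoint] by (simp add: disjnt_def)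
  qed
  show "compact D \<and> connected D \<and> finite (components (- D))" if "D \<in> subdrawing ` reach ` verts G"
    using that compact_subdrawing[OF reach_subset] connected_subdrawing_reach finite_components_reach
    by auto
qed

lemma finite_faces: "finite (faces G pos crv)"
  unfolding faces_def drawing_image_Union
  by (rule finite_components_Union) (use finite_reach_drawings in auto)

lemma interior_drawing_image: "interior (drawing_image G pos crv) = {}"
proof -
  have "interior (\<Union>e\<in>E. path_image (crv e)) = {}" if "finite E" "E \<subseteq> arcs G" for E
    using that
  proof (induction E)
    case (insert e E)
    then show ?case
      using interior_closed_Un_empty_interior[of "path_image (crv e)" "\<Union>e\<in>E. path_image (crv e)"]
        interior_path_image_arc[of "crv e"] arc_crv[of e] by (simp add: closed_arc_image)
  qed simp
  then have "interior (\<Union>e\<in>arcs G. path_image (crv e)) = {}"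
    by simp
  moreover have "interior (pos ` verts G) = {}"
    by (simp add: empty_interior_finite)
  ultimately show ?thesis
    unfolding drawing_image_def
    by (simp add: interior_closed_Un_empty_interior finite_imp_closed)
qed

text \<open>The drawing has empty interior and there are finitely many faces, so their closures
  cover the plane. Consequently all faces together form a finite face cover, and the
  \<open>LEAST\<close> in \<open>face_cover_number\<close> is attained rather than
  arbitrary.\<close>

lemma vertex_on_face:
  assumes "v \<in> verts G"
  shows "\<exists>f\<in>faces G pos crv. pos v \<in> frontier f"
proof -
  have "closure (- drawing_image G pos crv) = UNIV"
    by (simp add: closure_complement interior_drawing_image)
  moreover have "closure (- drawing_image G pos crv) \<subseteq> \<Union>(closure ` faces G pos crv)"
  proof (rule closure_minimal)
    show "- drawing_image G pos crv \<subseteq> \<Union>(closure ` faces G pos crv)"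
      using Union_components[of "- drawing_image G pos crv"] closure_subset
      unfolding faces_def by blast
    show "closed (\<Union>(closure ` faces G pos crv))"
      using finite_faces by (intro closed_Union) auto
  qed
  ultimately obtain f where f: "f \<in> faces G pos crv" "pos v \<in> closure f"
    by blast
  moreover have "pos v \<notin> interior f"
    using f(1) assms in_components_subset interior_subset by (fastforce simp: faces_def drawing_image_def)
  ultimately show ?thesis
    by (auto simp: frontier_def)
qed

lemma optimal_face_cover:
  assumes "K \<subseteq> verts G"
  obtains F where "face_cover G pos crv K F" "finite F" "card F = face_cover_number G pos crv K"
proof -
  have "face_cover G pos crv K (faces G pos crv)"
    using vertex_on_face assms by (auto simp: face_cover_def)
  then have "\<exists>n F. face_cover G pos crv K F \<and> finite F \<and> card F = n"
    using finite_faces by blast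
  then show ?thesis
    using LeastI_ex[of "\<lambda>n. \<exists>F. face_cover G pos crv K F \<and> finite F \<and> card F = n"] that
    unfolding face_cover_number_def by blast
qed

text \<open>Whichever component of \<open>G\<close> is considered, that of \<open>r\<close> or that
  of \<open>s\<close> is different from it and joins \<open>f\<close> to \<open>g\<close> off its
  drawing. So no single component separates \<open>f\<close> from \<open>g\<close>, and then neither
  does the whole drawing.\<close>

lemma common_face_unique:
  assumes f: "f \<in> faces G pos crv" "g \<in> faces G pos crv"
    and r: "closure f \<inter> subdrawing (reach r) \<noteq> {}" "closure g \<inter> subdrawing (reach r) \<noteq> {}"
    and s: "closure f \<inter> subdrawing (reach s) \<noteq> {}" "closure g \<inter> subdrawing (reach s) \<noteq> {}"
    and rs: "reach r \<noteq> reach s"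
  shows "f = g"
proof -
  have comp: "f \<in> components (- drawing_image G pos crv)" "g \<in> components (- drawing_image G pos crv)"
    using f by (simp_all add: faces_def)
  note con = in_components_connected[OF comp(1)] in_components_connected[OF comp(2)]
  obtain a b where ab: "a \<in> f" "b \<in> g"
    using in_components_nonempty[OF comp(1)] in_components_nonempty[OF comp(2)] by blast
  have avoid: "f \<inter> subdrawing (reach x) = {}" "g \<inter> subdrawing (reach x) = {}" for x
    using in_components_subset[OF comp(1)] in_components_subset[OF comp(2)]
      subdrawing_mono[OF reach_subset] subdrawing_verts by blast+
  have link: "connected_component (- subdrawing (reach q)) a b"
    if q: "reach q \<noteq> reach x" and fx: "closure f \<inter> subdrawing (reach x) \<noteq> {}"
      and gx: "closure g \<inter> subdrawing (reach x) \<noteq> {}" for q x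
  proof -
    have "connected (f \<union> subdrawing (reach x))" "connected (g \<union> subdrawing (reach x))"
      using connected_Un_closure[OF con(1) connected_subdrawing_reach fx]
        connected_Un_closure[OF con(2) connected_subdrawing_reach gx] .
    then have "connected ((f \<union> subdrawing (reach x)) \<union> (g \<union> subdrawing (reach x)))"
      by (rule connected_Un) (use fx in blast)
    moreover have "subdrawing (reach q) \<inter> subdrawing (reach x) = {}"
      by (rule subdrawing_disjoint[OF reach_subset reach_subset reach_disjoint[OF q]])
    then have "(f \<union> subdrawing (reach x)) \<union> (g \<union> subdrawing (reach x)) \<subseteq> - subdrawing (reach q)"
      using avoid[of q] by blast
    ultimately show ?thesis
      unfolding connected_component_def using ab
      by (intro exI[of _ "(f \<union> subdrawing (reach x)) \<union> (g \<union> subdrawing (reach x))"]) simp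
  qed
  have "connected_component (- subdrawing (reach q)) a b" for q
    using link[OF _ r] link[OF _ s] rs by (cases "reach q = reach r") auto
  then have "connected_component (- drawing_image G pos crv) a b"
    unfolding drawing_image_Union
    by (intro separated_by_member finite_reach_drawings(1,2)) (use finite_reach_drawings(3) in auto)
  then obtain S where S: "connected S" "S \<subseteq> - drawing_image G pos crv" "a \<in> S" "b \<in> S"
    unfolding connected_component_def by blast
  have "S \<subseteq> f"
    using components_maximal[OF comp(1) S(1,2)] S(3) ab by blast
  then have "f \<inter> g \<noteq> {}"
    using S(4) ab(2) by blast
  then show ?thesis
    using components_nonoverlap[OF comp] by blast
qed

text \<open>Every set in \<open>A\<close> lies in some face of the restricted drawing; several may
  fall into the same face, which only lowers the count. Asking for connected sets instead of faces
  lets one bound serve the faces of \<open>G\<close> and those of a single component alike.\<close>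

lemma face_cover_number_le:
  assumes A: "finite A" and sets: "\<And>f. f \<in> A \<Longrightarrow> connected f \<and> f \<noteq> {} \<and> f \<inter> subdrawing C = {}"
    and cover: "\<And>t. t \<in> K \<Longrightarrow> t \<in> C \<and> (\<exists>f\<in>A. pos t \<in> closure f)"
  shows "face_cover_number (G \<restriction> C) pos crv K \<le> card A"
proof -
  have "\<exists>g. g \<in> faces (G \<restriction> C) pos crv \<and> f \<subseteq> g" if "f \<in> A" for f
  proof -
    have "f \<subseteq> - subdrawing C" "- subdrawing C \<noteq> {}"
      using sets[OF that] by blast+
    then show ?thesis
      using exists_component_superset[of f "- subdrawing C"] sets[OF that]
      by (auto simp: faces_def subdrawing_def)
  qed
  then obtain h where h: "\<And>f. f \<in> A \<Longrightarrow> h f \<in> faces (G \<restriction> C) pos crv \<and> f \<subseteq> h f"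
    by metis
  have "face_cover (G \<restriction> C) pos crv K (h ` A)"
    unfolding face_cover_def
  proof (intro conjI ballI)
    show "h ` A \<subseteq> faces (G \<restriction> C) pos crv"
      using h by blast
    fix t assume t: "t \<in> K"
    then obtain f where f: "f \<in> A" "pos t \<in> closure f" and tC: "t \<in> C"
      using cover by blast
    have "pos t \<in> closure (h f)"
      using f h closure_mono by blast
    moreover have "pos t \<in> subdrawing C"
      using tC by (simp add: subdrawing_eq)
    then have "pos t \<notin> h f"
      using h[OF f(1)] in_components_subset unfolding faces_def subdrawing_def by blast
    then have "pos t \<notin> interior (h f)"
      using interior_subset by blast
    ultimately have "pos t \<in> frontier (h f)"
      by (simp add: frontier_def)
    then show "\<exists>g\<in>h ` A. pos t \<in> frontier g"
      using f(1) by blast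
  qed
  then have "face_cover_number (G \<restriction> C) pos crv K \<le> card (h ` A)"
    unfolding face_cover_number_def using A by (intro Least_le) blast
  also have "\<dots> \<le> card A"
    using A by (rule card_image_le)
  finally show ?thesis .
qed

lemma connected_component_vertsD:
  assumes "connected_component_verts (G \<restriction> B) C" "B \<subseteq> verts G"
  shows "C \<subseteq> B" "C \<noteq> {}" "connected (subdrawing C)" "x \<in> C \<Longrightarrow> C \<subseteq> reach x"
proof -
  obtain H where H: "subgraph H (G \<restriction> B)" "Digraph_Component.connected H" "C = verts H"
    using assms(1) by (auto simp: connected_component_verts_def pre_digraph.max_subgraph_def)
  then have sub: "C \<subseteq> B" "arcs H \<subseteq> arcs G" "tail H = tail G" "head H = head G"
    by (auto simp: subgraph_def compatible_def)
  have wf: "wf_digraph H"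
    using H(1) by (simp add: subgraph_def)
  show "C \<subseteq> B"
    by (rule sub(1))
  have strong: "strongly_connected (mk_symmetric H)"
    using H(2) by (simp add: Digraph_Component.connected_def)
  then show "C \<noteq> {}"
    using H(3) by (simp add: strongly_connected_def)
  have path: "(x, y) \<in> (adjacency C)\<^sup>*" if "x \<in> C" "y \<in> C" for x y
  proof -
    have "reachable (mk_symmetric H) x y"
      using strong that H(3) by (simp add: strongly_connected_def)
    then have "(x, y) \<in> (arcs_ends (mk_symmetric H))\<^sup>*"
      by (rule reachable_rtranclI)
    moreover have "arcs_ends (mk_symmetric H) \<subseteq> adjacency C"
    proof
      fix ab assume "ab \<in> arcs_ends (mk_symmetric H)"
      then obtain e where e: "e \<in> arcs H" "ab = (tail H e, head H e) \<or> ab = (head H e, tail H e)"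
        by (auto simp: parcs_mk_symmetric)
      then have "tail H e \<in> C" "head H e \<in> C" "e \<in> arcs G"
        using wf sub(2) H(3) by (auto simp: wf_digraph_def)
      then show "ab \<in> adjacency C"
        using e(2) sub(3,4) by (auto simp: adjacency_def arc_vs_def)
    qed
    ultimately show ?thesis
      using rtrancl_mono by blast
  qed
  then show "connected (subdrawing C)"
    by (rule connected_subdrawing)
  show "C \<subseteq> reach x" if "x \<in> C"
  proof
    fix y assume "y \<in> C"
    with path[OF that] have "(x, y) \<in> (adjacency C)\<^sup>*" .
    then show "y \<in> reach x"
    proof (induction rule: rtrancl_induct)
      case base
      then show ?case
        using that sub(1) assms(2) root_in_reach by blast
    next
      case (step y z)
      then obtain e where "e \<in> arcs G" "arc_vs G e = {y, z}"
        by (auto simp: adjacency_def)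
      then show ?case
        using arc_vs_reach[of e x] step(3) by blast
    qed
  qed
qed

end

section \<open>Choice of the component and transfer of the face cover to it\<close>

theorem theorem5:
  fixes G :: "('a, 'b) pre_digraph"
    and w :: "'b \<Rightarrow> real"
    and pos :: "'a \<Rightarrow> complex"
    and crv :: "'b \<Rightarrow> real \<Rightarrow> complex"
    and K :: "'a set"
    and \<gamma> :: nat
  assumes "plane_drawing G pos crv"
    and "verts G \<noteq> {}"
    and "edge_weight G w"
    and "K \<subseteq> verts G"
    and "face_cover_number G pos crv K = \<gamma>"
  shows "\<exists>u\<^sub>1 P\<^sub>1 v\<^sub>1 u\<^sub>2 P\<^sub>2 v\<^sub>2.
    shortest_path G w u\<^sub>1 P\<^sub>1 v\<^sub>1 \<and> shortest_path G w u\<^sub>2 P\<^sub>2 v\<^sub>2 \<and>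
    (\<forall>C. connected_component_verts
           (G \<restriction> (verts G - (set (pre_digraph.awalk_verts G u\<^sub>1 P\<^sub>1) \<union>
                            set (pre_digraph.awalk_verts G u\<^sub>2 P\<^sub>2)))) C \<longrightarrow>
         real (face_cover_number (G \<restriction> C) pos crv (K \<inter> C)) \<le> 2 / 3 * real \<gamma> + 1)"
proof -
  interpret plane_drawing G pos crv by (rule assms(1))
  obtain F where F: "face_cover G pos crv K F" "finite F" "card F = \<gamma>"
    using optimal_face_cover[OF assms(4)] assms(5) by metis
  have F_faces: "F \<subseteq> faces G pos crv"
    using F(1) by (simp add: face_cover_def)
  have F_props: "connected f \<and> f \<noteq> {} \<and> f \<inter> subdrawing A = {}" if "f \<in> F" "A \<subseteq> verts G" for f A
  proof -
    have f: "f \<in> components (- drawing_image G pos crv)"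
      using F_faces that(1) by (auto simp: faces_def)
    then show ?thesis
      using in_components_connected[OF f] in_components_nonempty[OF f] in_components_subset[OF f]
        subdrawing_mono[OF that(2)] subdrawing_verts by blast
  qed
  have covered: "\<exists>f\<in>F. pos t \<in> closure f" if "t \<in> K" for t
    using F(1) that by (auto simp: face_cover_def frontier_def)
  define touching where "touching r = {f \<in> F. closure f \<inter> subdrawing (reach r) \<noteq> {}}" for r
  define M where "M = Max ((\<lambda>r. card (touching r)) ` verts G)"
  have "M \<in> (\<lambda>r. card (touching r)) ` verts G"
    unfolding M_def using assms(2) by (intro Max_in) auto
  then obtain r where r: "r \<in> verts G" "card (touching r) = M"
    by blast
  have max: "card (touching s) \<le> card (touching r)" if "s \<in> verts G" for s
    unfolding r(2) M_def using that by (intro Max_ge) auto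
  \<comment> \<open>The members of \<open>F\<close> are faces of the whole drawing, while the
    separator is taken in the drawing of one component. A face of the latter that contains members
    of \<open>F\<close> counts once; picking one member from each shows
    \<open>card \<Phi> \<le> \<gamma>\<close>.\<close>
  define \<Phi> where "\<Phi> = {U \<in> components (- subdrawing (reach r)). \<exists>f\<in>F. f \<subseteq> U}"
  have \<Phi>_sub: "\<Phi> \<subseteq> components (- subdrawing (reach r))"
    by (auto simp: \<Phi>_def)
  have "\<exists>h. \<forall>U\<in>\<Phi>. h U \<in> F \<and> h U \<subseteq> U"
    by (intro bchoice) (auto simp: \<Phi>_def)
  then obtain h where h: "\<And>U. U \<in> \<Phi> \<Longrightarrow> h U \<in> F \<and> h U \<subseteq> U"
    by blast
  have "inj_on h \<Phi>"
  proof (rule inj_onI)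
    fix U U' assume U: "U \<in> \<Phi>" "U' \<in> \<Phi>" "h U = h U'"
    then have "U \<inter> U' \<noteq> {}"
      using h F_props[of "h U" "{}"] by blast
    moreover have "U \<in> components (- subdrawing (reach r))" "U' \<in> components (- subdrawing (reach r))"
      using U by (simp_all add: \<Phi>_def)
    ultimately show "U = U'"
      using components_nonoverlap by metis
  qed
  then have \<Phi>: "finite \<Phi>" "card \<Phi> \<le> \<gamma>"
    using h F(2,3) inj_on_finite[of h \<Phi> F] card_inj_on_le[of h \<Phi> F] by auto
  obtain u v P Q where P: "shortest_path G w r P u" and Q: "shortest_path G w r Q v"
    and sep: "\<forall>C. C \<subseteq> reach r - (set (awalk_verts r P) \<union> set (awalk_verts r Q)) \<longrightarrow>
      connected (subdrawing C) \<longrightarrow>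
      real (card {f \<in> \<Phi>. closure f \<inter> subdrawing C \<noteq> {}}) \<le> 2 / 3 * real (card \<Phi>) + 1"
    by (rule component_separator[OF assms(3) r(1) \<Phi>(1) \<Phi>_sub]) (rule that)
  have "real (face_cover_number (G \<restriction> C) pos crv (K \<inter> C)) \<le> 2 / 3 * real \<gamma> + 1"
    if C: "connected_component_verts
      (G \<restriction> (verts G - (set (awalk_verts r P) \<union> set (awalk_verts r Q)))) C" for C
  proof -
    note comp = connected_component_vertsD[OF C Diff_subset]
    obtain x where x: "x \<in> C"
      using comp(2) by blast
    have CG: "C \<subseteq> verts G" and Cx: "C \<subseteq> reach x"
      using comp(1) comp(4)[OF x] by auto
    have posC: "pos t \<in> subdrawing C" if "t \<in> C" for t
      using that by (simp add: subdrawing_eq)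
    show ?thesis
    proof (cases "x \<in> reach r")
      case True
      then have Cr: "C \<subseteq> reach r"
        using Cx reach_eq by blast
      define A where "A = {f \<in> \<Phi>. closure f \<inter> subdrawing C \<noteq> {}}"
      have "face_cover_number (G \<restriction> C) pos crv (K \<inter> C) \<le> card A"
      proof (rule face_cover_number_le)
        show "finite A"
          using \<Phi>(1) by (simp add: A_def)
        show "connected U \<and> U \<noteq> {} \<and> U \<inter> subdrawing C = {}" if "U \<in> A" for U
        proof -
          have U: "U \<in> components (- subdrawing (reach r))"
            using that by (simp add: A_def \<Phi>_def)
          show ?thesis
            using in_components_connected[OF U] in_components_nonempty[OF U] in_components_subset[OF U]
              subdrawing_mono[OF Cr] by blast
        qed
        show "t \<in> C \<and> (\<exists>U\<in>A. pos t \<in> closure U)" if t: "t \<in> K \<inter> C" for t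
        proof -
          obtain f where f: "f \<in> F" "pos t \<in> closure f"
            using covered t by blast
          note props = F_props[OF f(1) reach_subset[of r]]
          then have "f \<subseteq> - subdrawing (reach r)" "- subdrawing (reach r) \<noteq> {}"
            by blast+
          then obtain U where U: "U \<in> components (- subdrawing (reach r))" "f \<subseteq> U"
            using exists_component_superset[of f "- subdrawing (reach r)"] props by blast
          then have "pos t \<in> closure U" "U \<in> \<Phi>"
            using f closure_mono[OF U(2)] by (auto simp: \<Phi>_def)
          then show ?thesis
            using t posC[of t] by (auto simp: A_def)
        qed
      qed
      moreover have "real (card A) \<le> 2 / 3 * real (card \<Phi>) + 1"
        unfolding A_def by (rule sep[rule_format]) (use comp(1,3) Cr in blast)+
      ultimately show ?thesis
        using \<Phi>(2) by linarith
    next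
      case False
      have xG: "x \<in> verts G"
        using x CG by blast
      have xr: "reach x \<noteq> reach r"
        using False root_in_reach[OF xG] by blast
      have "face_cover_number (G \<restriction> C) pos crv (K \<inter> C) \<le> card (touching x)"
      proof (rule face_cover_number_le)
        show "finite (touching x)"
          using F(2) by (simp add: touching_def)
        show "connected f \<and> f \<noteq> {} \<and> f \<inter> subdrawing C = {}" if "f \<in> touching x" for f
          using F_props[OF _ CG] that by (simp add: touching_def)
        show "t \<in> C \<and> (\<exists>f\<in>touching x. pos t \<in> closure f)" if t: "t \<in> K \<inter> C" for t
          using covered[of t] t posC[of t] subdrawing_mono[OF Cx] by (auto simp: touching_def)
      qed
      moreover have "card (touching x) \<le> card (touching r)"
        by (rule max[OF xG])
      \<comment> \<open>At most one face is shared, hence the \<open>+ 1\<close>. With the maximal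
        choice of \<open>r\<close>, twice \<open>card (touching x)\<close> is at most
        \<open>\<gamma> + 1\<close>, and half of \<open>\<gamma> + 1\<close> never exceeds
        \<open>2 / 3 * \<gamma> + 1\<close>.\<close>
      moreover have "card (touching x) + card (touching r) \<le> \<gamma> + 1"
      proof -
        have fin: "finite (touching x)" "finite (touching r)"
          using F(2) by (simp_all add: touching_def)
        have "card (touching x \<inter> touching r) \<le> 1"
        proof (rule card_le_Suc0_iff_eq[THEN iffD2, folded One_nat_def])
          show "\<forall>f\<in>touching x \<inter> touching r. \<forall>g\<in>touching x \<inter> touching r. f = g"
            using common_face_unique[OF _ _ _ _ _ _ xr] F_faces by (auto simp: touching_def)
        qed (use fin in simp)
        moreover have "card (touching x \<union> touching r) \<le> \<gamma>"
          unfolding F(3)[symmetric] using F(2) by (intro card_mono) (auto simp: touching_def)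
        ultimately show ?thesis
          using card_Un_Int[OF fin] by linarith
      qed
      ultimately show ?thesis
        by linarith
    qed
  qed
  then show ?thesis
    using P Q by blast
qed

end
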